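(* Every compact abelian topological group $G$ admits a dense subgroup $H$ such that $d(H)=w(G)$.
   Context: All topological groups are assumed to be Hausdorff. For a topological space $X$, the density $d(X)$ is the minimum cardinal $\tau$ such that $X$ has a dense subset of cardinality $\tau$, and the weight $w(X)$ is the minimum cardinality of a base for the topology of $X$. A subgroup $H$ of $G$ carries the subspace topology; $d(H)$ is computed in that topology. *)

theory Defs
  imports "HOL-Analysis.Analysis"
begin

unbundle cardinal_syntax

text \<open>
  Cardinals are represented by well-orders as in \<open>BNF_Cardinal_Order_Relation\<close>: \<open>|A|\<close> is the
  cardinal of \<open>A\<close>, and \<open>\<le>o\<close>, \<open>=o\<close> compare cardinals over possibly different types. This keeps
  infinite cardinalities apart, which \<open>card\<close> does not.
\<close>

definition min_card :: "'b set set \<Rightarrow> 'b rel" where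
  "min_card F = (SOME r. r \<in> card_of ` F \<and> (\<forall>s \<in> card_of ` F. r \<le>o s))"

definition dense_in :: "'a topology \<Rightarrow> 'a set \<Rightarrow> bool" where
  "dense_in X D \<longleftrightarrow> D \<subseteq> topspace X \<and> X closure_of D = topspace X"

definition base_in :: "'a topology \<Rightarrow> 'a set set \<Rightarrow> bool" where
  "base_in X \<B> \<longleftrightarrow>
     (\<forall>B \<in> \<B>. openin X B) \<and> (\<forall>U. openin X U \<longrightarrow> (\<exists>\<B>' \<subseteq> \<B>. \<Union>\<B>' = U))"

definition top_density :: "'a topology \<Rightarrow> 'a rel" where
  "top_density X = min_card {D. dense_in X D}"

definition top_weight :: "'a topology \<Rightarrow> 'a set rel" where
  "top_weight X = min_card {\<B>. base_in X \<B>}"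

definition add_subgroup :: "'a::group_add set \<Rightarrow> bool" where
  "add_subgroup H \<longleftrightarrow> 0 \<in> H \<and> (\<forall>x \<in> H. \<forall>y \<in> H. x + y \<in> H) \<and> (\<forall>x \<in> H. - x \<in> H)"

text \<open>The choice in \<open>min_card\<close> is harmless: the minimum is attained.\<close>

lemma min_card_attained:
  assumes "F \<noteq> {}"
  shows "\<exists>A \<in> F. min_card F = |A| \<and> (\<forall>B \<in> F. |A| \<le>o |B| )"
proof -
  have "\<exists>r \<in> card_of ` F. \<forall>s \<in> card_of ` F. r \<le>o s"
    by (rule exists_minim_Card_order) (use assms in \<open>auto intro: card_of_Card_order\<close>)
  then have "\<exists>r. r \<in> card_of ` F \<and> (\<forall>s \<in> card_of ` F. r \<le>o s)"
    by blast
  from someI_ex[OF this, folded min_card_def] show ?thesis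
    by auto
qed

lemma top_density_attained:
  "\<exists>D. dense_in X D \<and> top_density X = |D| \<and> (\<forall>E. dense_in X E \<longrightarrow> |D| \<le>o |E| )"
proof -
  have "dense_in X (topspace X)"
    by (simp add: dense_in_def)
  then have "{D. dense_in X D} \<noteq> {}"
    by blast
  from min_card_attained[OF this] show ?thesis
    by (auto simp: top_density_def)
qed

lemma top_weight_attained:
  "\<exists>\<B>. base_in X \<B> \<and> top_weight X = |\<B>| \<and> (\<forall>\<C>. base_in X \<C> \<longrightarrow> |\<B>| \<le>o |\<C>| )"
proof -
  have "base_in X {U. openin X U}"
    unfolding base_in_def by (auto intro!: exI[of _ "{_}"])
  then have "{\<B>. base_in X \<B>} \<noteq> {}"
    by blast
  from min_card_attained[OF this] show ?thesis
    by (auto simp: top_weight_def)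
qed

end

theory Submission
  imports Defs "HOL-Computational_Algebra.Primes"
begin

text \<open>
  Every subspace has density at most the weight \<open>\<kappa>\<close> of the group, so the task is to find a dense
  subgroup in which no set of fewer than \<open>\<kappa>\<close> points is dense. In a product of \<open>\<kappa>\<close> circles, with
  \<open>\<kappa>\<close> infinite, the direct sum is such a subgroup: fewer than \<open>\<kappa>\<close> points of finite support leave
  some coordinate untouched and therefore lie in a proper closed subgroup. In general the
  coordinates are replaced by a maximal independent set \<open>I\<close> of continuous characters, and the
  subgroup consists of the points at which all but finitely many members of \<open>I\<close> have the value \<open>1\<close>
  (\<open>finite_support\<close>). If \<open>I\<close> is infinite, it has at least \<open>\<kappa>\<close> members: the group generated by \<open>I\<close>
  is essential in the group of all continuous characters, which is therefore not larger than \<open>I\<close>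
  (\<open>card_of_cont_chars\<close>), and the characters provide a base of the topology
  (\<open>weight_le_characters\<close>). Density of the subgroup is duality: a character that is trivial on it
  lies in the span of every cofinite part of \<open>I\<close> (\<open>char_group_annihilator\<close>), hence is trivial by
  independence. If \<open>I\<close> is finite, the weight is countable and the whole group will do.

  All this needs enough continuous characters: they must separate points from closed subgroups
  (\<open>separating_character\<close>). The existence proof uses neither Haar measure nor spectral theory.
  Averages over finitely many translates define an invariant mean on the continuous functions. For
  a continuous function \<open>f \<noteq> 0\<close> the autocorrelation \<open>y \<mapsto> mean (\<lambda>x. f x * f (x + y))\<close> is positive
  definite, and the extreme points of the compact convex set of normalised positive definite
  functions on the discrete group are characters. Maximising a suitable affine functional over
  this set gives a possibly discontinuous character \<open>\<xi>\<close> for which the averages of \<open>f\<close> times the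
  conjugate of \<open>\<xi>\<close> do not become small (\<open>correlated_character\<close>). Such a character inherits
  continuity and all periods from \<open>f\<close>, so it remains to apply this to a function adapted to the
  given subgroup and point.
\<close>

section \<open>The invariant mean of a compact abelian group\<close>

definition avg :: "'a list \<Rightarrow> ('a::ab_group_add \<Rightarrow> 'b::real_vector) \<Rightarrow> 'a \<Rightarrow> 'b" where
  "avg L f x = (\<Sum>g\<leftarrow>L. f (x + g)) /\<^sub>R real (length L)"

definition list_plus :: "'a::plus list \<Rightarrow> 'a list \<Rightarrow> 'a list" where
  "list_plus K L = concat (map (\<lambda>g. map ((+) g) L) K)"

lemma length_list_plus: "length (list_plus K L) = length K * length L"
  by (induction K) (auto simp: list_plus_def)

lemma list_plus_eq_Nil_iff [simp]: "list_plus K L = [] \<longleftrightarrow> K = [] \<or> L = []"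
  by (metis length_0_conv length_list_plus mult_eq_0_iff)

lemma scaleR_sum_list:
  fixes f :: "'a \<Rightarrow> 'b::real_vector"
  shows "c *\<^sub>R (\<Sum>x\<leftarrow>xs. f x) = (\<Sum>x\<leftarrow>xs. c *\<^sub>R f x)"
  by (induction xs) (auto simp: scaleR_add_right)

lemma avg_avg: "avg K (avg L f) = avg (list_plus K L) f"
proof
  fix x
  have "(\<Sum>g\<leftarrow>K. \<Sum>h\<leftarrow>L. f (x + g + h)) = (\<Sum>g\<leftarrow>list_plus K L. f (x + g))"
    by (induction K) (auto simp: list_plus_def add.assoc o_def)
  then show "avg K (avg L f) x = avg (list_plus K L) f x"
    by (simp add: avg_def length_list_plus flip: scaleR_sum_list)
qed

lemma sum_list_swap:
  fixes f :: "'a \<Rightarrow> 'b \<Rightarrow> 'c::comm_monoid_add"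
  shows "(\<Sum>x\<leftarrow>xs. \<Sum>y\<leftarrow>ys. f x y) = (\<Sum>y\<leftarrow>ys. \<Sum>x\<leftarrow>xs. f x y)"
  by (induction xs) (auto simp: sum_list_addf)

lemma avg_commute: "avg K (avg L f) = avg L (avg K f)"
proof
  fix x
  have "(\<Sum>g\<leftarrow>K. \<Sum>h\<leftarrow>L. f (x + g + h)) = (\<Sum>h\<leftarrow>L. \<Sum>g\<leftarrow>K. f (x + g + h))"
    by (rule sum_list_swap)
  then show "avg K (avg L f) x = avg L (avg K f) x"
    by (simp add: avg_def mult.commute add_ac flip: scaleR_sum_list)
qed

lemma avg_add: "avg L (\<lambda>x. f x + g x) x = avg L f x + avg L g x"
  by (simp add: avg_def sum_list_addf scaleR_add_right)

lemma sum_list_linear: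
  assumes "linear h"
  shows "h (\<Sum>x\<leftarrow>xs. f x) = (\<Sum>x\<leftarrow>xs. h (f x))"
  by (induction xs) (auto simp: linear_0[OF assms] linear_add[OF assms])

lemma avg_linear: "linear h \<Longrightarrow> avg L (\<lambda>x. h (f x)) x = h (avg L f x)"
  by (simp add: avg_def sum_list_linear linear_scale)

lemma avg_diff: "avg L (\<lambda>x. f x - g x) x = avg L f x - avg L g x"
  by (simp add: avg_def sum_list_subtractf scaleR_diff_right)

lemma sum_list_constant_scaleR:
  fixes c :: "'b::real_vector"
  shows "(\<Sum>x\<leftarrow>xs. c) = real (length xs) *\<^sub>R c"
  by (induction xs) (auto simp: scaleR_add_left)

lemma avg_const: "L \<noteq> [] \<Longrightarrow> avg L (\<lambda>x. c) x = c"
  by (simp add: avg_def sum_list_constant_scaleR)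

lemma avg_translate: "avg L (\<lambda>x. f (x + a)) x = avg L f (x + a)"
  by (simp add: avg_def add_ac)

lemma avg_mono:
  fixes f :: "'a::ab_group_add \<Rightarrow> real"
  assumes "\<And>x. f x \<le> g x"
  shows "avg L f x \<le> avg L g x"
  unfolding avg_def by (auto intro!: mult_left_mono sum_list_mono assms)

lemma norm_avg_le:
  assumes "L \<noteq> []" "\<And>x. norm (f x) \<le> c"
  shows "norm (avg L f x) \<le> c"
proof -
  have "norm (\<Sum>g\<leftarrow>L. f (x + g)) \<le> real (length L) * c" for L
  proof (induction L)
    case (Cons a L)
    then show ?case
      using norm_triangle_ineq[of "f (x + a)" "\<Sum>g\<leftarrow>L. f (x + g)"] assms(2)[of "x + a"]
      by (simp add: algebra_simps)
  qed simp
  then show ?thesis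
    using assms(1) by (simp add: avg_def field_simps)
qed

lemma norm_avg_diff_le:
  assumes "L \<noteq> []" "\<And>x. norm (f x - m) \<le> c"
  shows "norm (avg L f x - m) \<le> c"
  using norm_avg_le[OF assms(1), of "\<lambda>x. f x - m" c x] assms
  by (simp add: avg_diff avg_const)

text \<open>
  The invariant integral enters only through finite averages of translates: the mean is the
  constant that they approximate uniformly. This replaces Haar measure, and it makes sense for
  functions on the group without any measurability.
\<close>

definition has_mean :: "('a::ab_group_add \<Rightarrow> 'b::real_normed_vector) \<Rightarrow> 'b \<Rightarrow> bool" where
  "has_mean f m \<longleftrightarrow> (\<forall>e>0. \<exists>L. L \<noteq> [] \<and> (\<forall>x. norm (avg L f x - m) \<le> e))"

text \<open>
  Translation averages commute and do not increase the distance to a constant, so the composition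
  of an average that is good for \<open>f\<close> with one that is good for \<open>g\<close> is good for both. Uniqueness
  and additivity of the mean rest on this.
\<close>

lemma has_mean_common:
  assumes "has_mean f m" "has_mean g n" "e > 0"
  obtains L where "L \<noteq> []" "\<And>x. norm (avg L f x - m) \<le> e" "\<And>x. norm (avg L g x - n) \<le> e"
proof -
  obtain K where K: "K \<noteq> []" "\<And>x. norm (avg K f x - m) \<le> e"
    using assms unfolding has_mean_def by blast
  obtain L where L: "L \<noteq> []" "\<And>x. norm (avg L g x - n) \<le> e"
    using assms unfolding has_mean_def by blast
  show thesis
  proof (rule that[of "list_plus K L"])
    show "list_plus K L \<noteq> []" using K L by simp
    show "norm (avg (list_plus K L) f x - m) \<le> e" for x
      unfolding avg_avg[symmetric] avg_commute[of K] by (intro norm_avg_diff_le K L)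
    show "norm (avg (list_plus K L) g x - n) \<le> e" for x
      unfolding avg_avg[symmetric] by (intro norm_avg_diff_le K L)
  qed
qed

lemma has_mean_unique:
  assumes "has_mean f m" "has_mean f n"
  shows "m = n"
proof (rule ccontr)
  assume "m \<noteq> n"
  then obtain L where "L \<noteq> []" and L: "\<And>x. norm (avg L f x - m) \<le> norm (m - n) / 3"
      "\<And>x. norm (avg L f x - n) \<le> norm (m - n) / 3"
    using has_mean_common[OF assms, of "norm (m - n) / 3"] by auto
  have "norm (m - n) > 0" using \<open>m \<noteq> n\<close> by simp
  moreover have "norm (m - n) \<le> norm (avg L f 0 - n) + norm (avg L f 0 - m)"
    using norm_triangle_ineq4[of "avg L f 0 - n" "avg L f 0 - m"] by simp
  ultimately show False
    using L(1)[of 0] L(2)[of 0] by linarith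
qed

lemma has_mean_add:
  assumes "has_mean f m" "has_mean g n"
  shows "has_mean (\<lambda>x. f x + g x) (m + n)"
  unfolding has_mean_def
proof (intro allI impI)
  fix e :: real assume "e > 0"
  then obtain L where L: "L \<noteq> []" "\<And>x. norm (avg L f x - m) \<le> e / 2"
      "\<And>x. norm (avg L g x - n) \<le> e / 2"
    using has_mean_common[OF assms, of "e / 2"] by auto
  have "norm (avg L (\<lambda>x. f x + g x) x - (m + n)) \<le> e" for x
    using norm_triangle_ineq[of "avg L f x - m" "avg L g x - n"] L(2,3)[of x]
    by (simp add: avg_add algebra_simps)
  with L(1) show "\<exists>L. L \<noteq> [] \<and> (\<forall>x. norm (avg L (\<lambda>x. f x + g x) x - (m + n)) \<le> e)" by blast
qed

lemma has_mean_const: "has_mean (\<lambda>x. c) c"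
  unfolding has_mean_def by (auto intro!: exI[of _ "[0]"] simp: avg_const)

lemma has_mean_linear:
  assumes "bounded_linear h" "has_mean f m"
  shows "has_mean (\<lambda>x. h (f x)) (h m)"
  unfolding has_mean_def
proof (intro allI impI)
  fix e :: real assume "e > 0"
  interpret h: bounded_linear h by fact
  obtain K where K: "K > 0" "\<And>x. norm (h x) \<le> norm x * K"
    using h.pos_bounded by blast
  obtain L where L: "L \<noteq> []" "\<And>x. norm (avg L f x - m) \<le> e / K"
    using assms(2) \<open>e > 0\<close> \<open>K > 0\<close> unfolding has_mean_def by (meson divide_pos_pos)
  have "norm (avg L (\<lambda>x. h (f x)) x - h m) \<le> e" for x
  proof -
    have "norm (h (avg L f x - m)) \<le> norm (avg L f x - m) * K" by (rule K)
    also have "\<dots> \<le> e" using L(2)[of x] K by (simp add: field_simps)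
    finally show ?thesis by (simp add: avg_linear h.linear_axioms h.diff)
  qed
  with L(1) show "\<exists>L. L \<noteq> [] \<and> (\<forall>x. norm (avg L (\<lambda>x. h (f x)) x - h m) \<le> e)" by blast
qed

lemma has_mean_sum_list:
  assumes "\<And>y. y \<in> set ys \<Longrightarrow> has_mean (f y) (m y)"
  shows "has_mean (\<lambda>x. \<Sum>y\<leftarrow>ys. f y x) (\<Sum>y\<leftarrow>ys. m y)"
  using assms by (induction ys) (auto intro!: has_mean_add has_mean_const)

lemma has_mean_translate: "has_mean f m \<Longrightarrow> has_mean (\<lambda>x. f (x + a)) m"
  unfolding has_mean_def by (simp add: avg_translate) meson

lemma has_mean_avg:
  assumes "has_mean f m" "L \<noteq> []"
  shows "has_mean (avg L f) m"
  unfolding has_mean_def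
proof (intro allI impI)
  fix e :: real assume "e > 0"
  then obtain K where K: "K \<noteq> []" "\<And>x. norm (avg K f x - m) \<le> e"
    using assms unfolding has_mean_def by blast
  have "norm (avg K (avg L f) x - m) \<le> e" for x
    unfolding avg_commute[of _ L] using assms(2) K(2) by (rule norm_avg_diff_le)
  with K(1) show "\<exists>K. K \<noteq> [] \<and> (\<forall>x. norm (avg K (avg L f) x - m) \<le> e)" by blast
qed

lemma has_mean_mono:
  fixes f g :: "'a::ab_group_add \<Rightarrow> real"
  assumes "has_mean f m" "has_mean g n" "\<And>x. f x \<le> g x"
  shows "m \<le> n"
proof (rule field_le_epsilon)
  fix e :: real assume "e > 0"
  then have "e / 2 > 0" by simp
  from assms(1,2) this obtain L where L: "L \<noteq> []"
    "\<And>x. norm (avg L f x - m) \<le> e / 2" "\<And>x. norm (avg L g x - n) \<le> e / 2"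
    by (rule has_mean_common) (rule that)
  have "avg L f 0 \<le> avg L g 0" by (rule avg_mono) (rule assms(3))
  with L(2)[of 0] L(3)[of 0] show "m \<le> n + e"
    unfolding real_norm_def by linarith
qed

lemma uniformly_small_shift:
  fixes f :: "'a::topological_ab_group_add \<Rightarrow> 'b::metric_space"
  assumes cpt: "compact (UNIV :: 'a set)" and f: "continuous_on UNIV f" and "e > 0"
  obtains V where "open V" "0 \<in> V" "\<And>x v. v \<in> V \<Longrightarrow> dist (f (x + v)) (f x) < e"
proof -
  define W where "W = {p. dist (f (snd p + fst p)) (f (snd p)) < e}"
  have "open W"
    unfolding W_def
    by (intro open_Collect_less continuous_intros continuous_on_compose2[OF f]) auto
  moreover have "{0} \<times> UNIV \<subseteq> W"
    using \<open>e > 0\<close> by (auto simp: W_def)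
  ultimately obtain V where "0 \<in> V" "open V" "V \<times> UNIV \<subseteq> W"
    using Elementary_Topology.tube_lemma[OF cpt, of W 0] by metis
  show thesis
  proof (rule that[of V])
    show "dist (f (x + v)) (f x) < e" if "v \<in> V" for x v
      using subsetD[OF \<open>V \<times> UNIV \<subseteq> W\<close>, of "(v, x)"] that by (simp add: W_def)
  qed fact+
qed

lemma finite_translates_cover:
  fixes V :: "'a::topological_ab_group_add set"
  assumes cpt: "compact (UNIV :: 'a set)" and V: "open V" "0 \<in> V"
  obtains K where "K \<noteq> []" "\<And>x. \<exists>g\<in>set K. x - g \<in> V"
proof -
  have "open ((\<lambda>x. x - g) -` V)" for g
    by (intro open_vimage V continuous_intros)
  then obtain C where "finite C" and C: "UNIV \<subseteq> (\<Union>g\<in>C. (\<lambda>x. x - g) -` V)"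
  proof (rule compactE_image[OF cpt, of UNIV "\<lambda>g. (\<lambda>x. x - g) -` V"])
    show "UNIV \<subseteq> (\<Union>g. (\<lambda>x. x - g) -` V)"
    proof
      show "x \<in> (\<Union>g. (\<lambda>x. x - g) -` V)" for x
        using V(2) by (intro UN_I[of x]) auto
    qed
  qed auto
  obtain K where K: "set K = C" using \<open>finite C\<close> finite_list by blast
  have "\<exists>g\<in>set K. x - g \<in> V" for x
    using C K by blast
  moreover from this have "K \<noteq> []" by force
  ultimately show thesis using that[of K] by blast
qed

lemma sum_list_le_of_member:
  fixes f :: "'a \<Rightarrow> real"
  assumes "\<And>x. x \<in> set xs \<Longrightarrow> f x \<le> c" "x \<in> set xs"
  shows "(\<Sum>x\<leftarrow>xs. f x) \<le> real (length xs) * c - (c - f x)"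
  using assms
proof (induction xs)
  case (Cons a xs)
  show ?case
  proof (cases "x \<in> set xs")
    case True
    then have "(\<Sum>x\<leftarrow>xs. f x) \<le> real (length xs) * c - (c - f x)"
      using Cons.IH Cons.prems(1) by simp
    moreover have "f a \<le> c" using Cons.prems(1) by simp
    ultimately show ?thesis by (simp add: algebra_simps)
  next
    case False
    then have "x = a" using Cons.prems by simp
    moreover have "(\<Sum>x\<leftarrow>xs. f x) \<le> real (length xs) * c"
      using sum_list_mono[of xs f "\<lambda>_. c"] Cons.prems(1) by (simp add: sum_list_triv)
    ultimately show ?thesis by (simp add: algebra_simps)
  qed
qed simp

text \<open>
  The candidate \<open>m\<close> is the infimum of all upper bounds of averages of \<open>f\<close>. Take an average \<open>h\<close> of
  \<open>f\<close> that stays below \<open>m + \<eta>\<close>. If \<open>h\<close> were much smaller than \<open>m\<close> at a single point, then, since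
  \<open>h\<close> is as uniformly continuous as \<open>f\<close> and finitely many translates of a neighbourhood of \<open>0\<close>
  cover the group, one further average over \<open>k\<close> translates would see this small value from every
  point and stay below \<open>m\<close>, contrary to the choice of \<open>m\<close>. So \<open>h\<close> is uniformly close to \<open>m\<close>.
\<close>

theorem has_mean_exists:
  fixes f :: "'a::topological_ab_group_add \<Rightarrow> real"
  assumes cpt: "compact (UNIV :: 'a set)" and f: "continuous_on UNIV f"
  obtains m where "has_mean f m"
proof -
  define S where "S = {s. \<exists>L. L \<noteq> [] \<and> (\<forall>x. avg L f x \<le> s)}"
  define m where "m = Inf S"
  obtain B where B: "\<And>x. norm (f x) \<le> B"
    using compact_imp_bounded[OF compact_continuous_image[OF f cpt]] unfolding bounded_iff by blast
  have "B \<in> S"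
    unfolding S_def using norm_avg_le[of "[0]" f B] B
    by (auto intro!: exI[of _ "[0]"] simp: abs_le_iff)
  have bdd: "bdd_below S"
    unfolding S_def
  proof (rule bdd_belowI[of _ "-B"])
    fix s assume "s \<in> {s. \<exists>L. L \<noteq> [] \<and> (\<forall>x. avg L f x \<le> s)}"
    then obtain L where "L \<noteq> []" "avg L f 0 \<le> s" by auto
    with norm_avg_le[of L f B 0] B show "- B \<le> s" by (auto simp: abs_le_iff)
  qed
  have "has_mean f m"
    unfolding has_mean_def
  proof (intro allI impI)
    fix e :: real assume "e > 0"
    define d where "d = e / 2"
    have "d > 0" using \<open>e > 0\<close> by (simp add: d_def)
    obtain V where V: "open V" "0 \<in> V" "\<And>x v. v \<in> V \<Longrightarrow> dist (f (x + v)) (f x) < d"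
      using uniformly_small_shift[OF cpt f \<open>d > 0\<close>] by blast
    obtain K where K: "K \<noteq> []" "\<And>x. \<exists>g\<in>set K. x - g \<in> V"
      using finite_translates_cover[OF cpt V(1,2)] by blast
    define k where "k = real (length K)"
    have "k \<ge> 1" using K(1) by (simp add: k_def Suc_leI)
    (* The excess d / k over the infimum is chosen so small that a gain of one k-th part of
       a deficit of order d, made by averaging over K, already leads below m. *)
    obtain s where s: "s \<in> S" "s < m + d / k"
      using cInf_lessD[of S "m + d / k"] \<open>B \<in> S\<close> \<open>d > 0\<close> \<open>k \<ge> 1\<close> unfolding m_def by auto
    then obtain L where L: "L \<noteq> []" "\<And>x. avg L f x \<le> s" unfolding S_def by blast
    have lower: "m - e \<le> avg L f y" for y
    proof -
      have "avg K (avg L f) x \<le> s - (s - (avg L f y + d)) / k" for x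
      proof -
        obtain g where g: "g \<in> set K" "y - x - g \<in> V" using K(2) by blast
        have "norm (avg L (\<lambda>z. f (z + (y - x - g)) - f z) (x + g)) \<le> d"
          using V(3)[OF g(2)] by (intro norm_avg_le L) (auto simp: dist_norm less_imp_le)
        then have "avg L f (x + g) \<le> avg L f y + d"
          by (simp add: avg_diff avg_translate)
        moreover have "(\<Sum>g\<leftarrow>K. avg L f (x + g)) \<le> k * s - (s - avg L f (x + g))"
          unfolding k_def by (rule sum_list_le_of_member) (use L g in auto)
        ultimately have "(\<Sum>g\<leftarrow>K. avg L f (x + g)) \<le> k * s - (s - (avg L f y + d))" by linarith
        then have "(\<Sum>g\<leftarrow>K. avg L f (x + g)) / k \<le> (k * s - (s - (avg L f y + d))) / k"
          using \<open>k \<ge> 1\<close> by (intro divide_right_mono) auto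
        also have "\<dots> = s - (s - (avg L f y + d)) / k"
          using \<open>k \<ge> 1\<close> by (simp add: field_simps)
        finally show ?thesis
          by (simp add: avg_def[of K] k_def divide_inverse mult.commute)
      qed
      then have "s - (s - (avg L f y + d)) / k \<in> S"
        unfolding S_def using K(1) L(1) by (auto simp: avg_avg intro!: exI[of _ "list_plus K L"])
      then have "m \<le> s - (s - (avg L f y + d)) / k"
        unfolding m_def using bdd by (rule cInf_lower)
      with s(2) have "(s - (avg L f y + d)) / k < d / k" by linarith
      then have "s - (avg L f y + d) < d" using \<open>k \<ge> 1\<close> by (simp add: divide_less_cancel)
      moreover have "m \<le> s" unfolding m_def using s(1) bdd by (rule cInf_lower)
      ultimately show ?thesis by (simp add: d_def)
    qed
    have "d / k \<le> d / 1" using \<open>k \<ge> 1\<close> \<open>d > 0\<close> by (intro divide_left_mono) auto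
    then have "d / k \<le> e" using \<open>e > 0\<close> by (simp add: d_def)
    then have "avg L f y \<le> m + e" for y using L(2)[of y] s(2) by linarith
    with lower L(1) show "\<exists>L. L \<noteq> [] \<and> (\<forall>x. norm (avg L f x - m) \<le> e)"
      by (intro exI[of _ L]) (auto simp: abs_le_iff algebra_simps)
  qed
  with that show thesis by blast
qed

lemma has_mean_pos:
  fixes f :: "'a::topological_ab_group_add \<Rightarrow> real"
  assumes cpt: "compact (UNIV :: 'a set)" and f: "continuous_on UNIV f"
    and nonneg: "\<And>x. f x \<ge> 0" and pos: "f a > 0" and m: "has_mean f m"
  shows "m > 0"
proof -
  define V where "V = {v. f (a - v) > f a / 2}"
  have "open V" unfolding V_def
    by (intro open_Collect_less continuous_intros continuous_on_compose2[OF f]) auto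
  moreover have "0 \<in> V" using pos by (simp add: V_def)
  ultimately obtain K where K: "K \<noteq> []" "\<And>x. \<exists>g\<in>set K. x - g \<in> V"
    using finite_translates_cover[OF cpt] by blast
  have "f a / 2 / length K \<le> avg K f x" for x
  proof -
    obtain g where g: "g \<in> set K" "(a - x) - g \<in> V" using K(2) by blast
    then have "f a / 2 \<le> f (x + g)" by (simp add: V_def algebra_simps)
    also have "\<dots> \<le> (\<Sum>g\<leftarrow>K. f (x + g))"
      using g nonneg by (intro member_le_sum_list) auto
    finally show ?thesis using K(1) by (simp add: avg_def field_simps)
  qed
  then have "f a / 2 / length K \<le> m"
    by (rule has_mean_mono[OF has_mean_const has_mean_avg[OF m K(1)]])
  moreover have "0 < f a / 2 / length K"
    using pos K(1) by simp
  ultimately show ?thesis by linarith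
qed

section \<open>Characters as extreme positive definite functions\<close>

text \<open>
  Coefficients and points are given as a list, so that a point may occur twice: concatenating a
  list with a translated copy of itself is then the algebra behind \<open>pd_form_shift\<close>.
\<close>

definition pd_form :: "('a::ab_group_add \<Rightarrow> complex) \<Rightarrow> (complex \<times> 'a) list \<Rightarrow> complex" where
  "pd_form p cs = (\<Sum>(c, y)\<leftarrow>cs. \<Sum>(d, w)\<leftarrow>cs. c * cnj d * p (y - w))"

definition pos_def :: "('a::ab_group_add \<Rightarrow> complex) \<Rightarrow> bool" where
  "pos_def p \<longleftrightarrow> (\<forall>cs. Im (pd_form p cs) = 0 \<and> Re (pd_form p cs) \<ge> 0)"

definition states :: "('a::ab_group_add \<Rightarrow> complex) set" where
  "states = {p. pos_def p \<and> p 0 = 1}"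

definition character :: "('a::ab_group_add \<Rightarrow> complex) \<Rightarrow> bool" where
  "character \<xi> \<longleftrightarrow> (\<forall>x y. \<xi> (x + y) = \<xi> x * \<xi> y) \<and> (\<forall>x. cmod (\<xi> x) = 1)"

lemma pd_form_pair:
  "pd_form p [(c, x), (d, y)] =
     (c * cnj c + d * cnj d) * p 0 + c * cnj d * p (x - y) + d * cnj c * p (y - x)"
  by (simp add: pd_form_def algebra_simps)

lemma pos_def_0:
  assumes "pos_def p"
  shows "Im (p 0) = 0" "Re (p 0) \<ge> 0"
  using assms[unfolded pos_def_def, rule_format, of "[(1, 0)]"] by (simp_all add: pd_form_def)

lemma pos_def_minus:
  assumes "pos_def p"
  shows "p (- x) = cnj (p x)"
proof -
  have "Im (p x + p (- x)) = 0" "Im (\<i> * p x - \<i> * p (- x)) = 0"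
    using assms[unfolded pos_def_def, rule_format, of "[(1, x), (1, 0)]"]
      assms[unfolded pos_def_def, rule_format, of "[(\<i>, x), (1, 0)]"] pos_def_0[OF assms]
    by (simp_all add: pd_form_pair)
  then show ?thesis by (simp add: complex_eq_iff)
qed

lemma pos_def_norm_le:
  assumes "pos_def p"
  shows "cmod (p x) \<le> Re (p 0)"
proof (cases "p x = 0")
  case True
  then show ?thesis using pos_def_0[OF assms] by simp
next
  case False
  define u where "u = - cnj (p x) / cmod (p x)"
  have u: "u * cnj u = 1" "u * p x = - cmod (p x)"
    using False complex_norm_square[of "p x"] by (auto simp: u_def power2_eq_square field_simps)
  have "cnj u * cnj (p x) = - cmod (p x)"
    unfolding complex_cnj_mult[symmetric] u by simp
  then have "pd_form p [(u, x), (1, 0)] = 2 * p 0 - 2 * cmod (p x)"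
    unfolding pd_form_pair using u by (simp add: pos_def_minus[OF assms] algebra_simps)
  with assms[unfolded pos_def_def, rule_format, of "[(u, x), (1, 0)]"] show ?thesis by simp
qed

lemma pd_form_linear:
  "pd_form (\<lambda>x. a * p x + b * q x) cs = a * pd_form p cs + b * pd_form q cs"
proof -
  have aux: "(\<Sum>(c, y)\<leftarrow>cs. a * F c y + b * G c y)
      = a * (\<Sum>(c, y)\<leftarrow>cs. F c y) + b * (\<Sum>(c, y)\<leftarrow>cs. G c y)" for F G :: "complex \<Rightarrow> 'a \<Rightarrow> complex" and cs
    by (induction cs) (auto simp: algebra_simps)
  show ?thesis
    unfolding pd_form_def aux[symmetric] by (simp add: algebra_simps)
qed

lemma pos_def_scale:
  assumes "pos_def p" "r \<ge> 0"
  shows "pos_def (\<lambda>x. of_real r * p x)"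
  using assms pd_form_linear[of "of_real r" p 0 p] by (simp add: pos_def_def)

lemma pd_form_shift:
  assumes z: "z * cnj z = 1"
  shows "pd_form (\<lambda>x. 2 * p x + (z * p (x + a) + cnj z * p (x - a))) cs
    = pd_form p (cs @ map (\<lambda>(c, y). (z * c, y + a)) cs)"
proof -
  have z': "z * (x * (cnj z * y)) = x * y" for x y using z by (metis mult.assoc mult.commute mult_1)
  have z'': "z * (cnj z * y) = y" for y using z by (metis mult.assoc mult_1)
  show ?thesis
    unfolding pd_form_def
    by (simp add: o_def case_prod_unfold)
       (simp add: z z' z'' algebra_simps flip: sum_list_addf)
qed

text \<open>
  On a mixture of characters \<open>\<xi>\<close> this operation multiplies the weight of \<open>\<xi>\<close> by
  \<open>1 + Re (z * \<xi> a) \<ge> 0\<close>; the two choices \<open>z\<close> and \<open>- z\<close> split \<open>p\<close> into two positive definite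
  halves.
\<close>

lemma pos_def_shift:
  assumes p: "pos_def p" and z: "z * cnj z = 1"
  shows "pos_def (\<lambda>x. p x + (z * p (x + a) + cnj z * p (x - a)) / 2)"
proof -
  have "pos_def (\<lambda>x. 2 * p x + (z * p (x + a) + cnj z * p (x - a)))"
    using p unfolding pos_def_def pd_form_shift[OF z] by blast
  from pos_def_scale[OF this, of "1/2"]
  have "pos_def (\<lambda>x. of_real (1 / 2) * (2 * p x + (z * p (x + a) + cnj z * p (x - a))))" by simp
  also have "(\<lambda>x. of_real (1 / 2) * (2 * p x + (z * p (x + a) + cnj z * p (x - a)))) =
      (\<lambda>x. p x + (z * p (x + a) + cnj z * p (x - a)) / 2)"
    by (simp add: fun_eq_iff field_simps)
  finally show ?thesis .
qed

definition extreme_in :: "('i \<Rightarrow> complex) set \<Rightarrow> ('i \<Rightarrow> complex) \<Rightarrow> bool" where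
  "extreme_in X p \<longleftrightarrow> p \<in> X \<and> (\<forall>q\<in>X. \<forall>r\<in>X. \<forall>t. 0 < t \<and> t < 1 \<and>
     p = (\<lambda>x. of_real t * q x + of_real (1 - t) * r x) \<longrightarrow> q = p)"

text \<open>
  By extremality both halves produced by \<open>pos_def_shift\<close> with \<open>z\<close> and \<open>- z\<close> are multiples of \<open>p\<close>.
  Comparing the results for \<open>z = 1\<close> and \<open>z = \<i>\<close> gives \<open>p (x + a) = p x * p a\<close>.
\<close>

theorem extreme_state_character:
  assumes "extreme_in states p"
  shows "character p"
proof -
  have p: "pos_def p" "p 0 = 1" using assms by (auto simp: extreme_in_def states_def)
  have key: "(z * p (x + a) + cnj z * p (x - a)) / 2 = of_real (Re (z * p a)) * p x"
    if z: "z * cnj z = 1" for z x a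
  proof -
    define P where "P s = (\<lambda>x. p x + (s * p (x + a) + cnj s * p (x - a)) / 2)" for s
    define \<rho> where "\<rho> = Re (z * p a)"
    have z2: "(- z) * cnj (- z) = 1" using z by simp
    have pd: "pos_def (P z)" "pos_def (P (- z))"
      unfolding P_def by (intro pos_def_shift p z z2)+
    have "z * p a + cnj z * p (- a) = z * p a + cnj (z * p a)"
      by (simp add: pos_def_minus[OF p(1)])
    also have "\<dots> = 2 * of_real \<rho>" by (simp only: \<rho>_def complex_add_cnj of_real_mult of_real_numeral)
    finally have P0: "P z 0 = 1 + of_real \<rho>" "P (- z) 0 = 1 - of_real \<rho>"
      by (auto simp: P_def p(2) field_simps)
    have nonneg: "1 + \<rho> \<ge> 0" "1 - \<rho> \<ge> 0"
      using pos_def_0(2)[OF pd(1)] pos_def_0(2)[OF pd(2)] by (simp_all add: P0)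
    have vanish: "q x = 0" if "pos_def q" "q 0 = 0" for q :: "'a \<Rightarrow> complex" and x
      using pos_def_norm_le[OF that(1), of x] that(2) by simp
    have "P z x = of_real (1 + \<rho>) * p x"
    proof -
      (* If one half vanishes at 0, it is identically 0 and the other half is 2 p;
         otherwise both can be normalised and p is a proper convex combination of them. *)
      consider "1 + \<rho> = 0" | "1 - \<rho> = 0" | "1 + \<rho> > 0" "1 - \<rho> > 0" using nonneg by linarith
      then show ?thesis
      proof cases
        case 1
        then have "P z 0 = 0" using P0 by (simp add: complex_eq_iff)
        from vanish[OF pd(1) this] show ?thesis using 1 by simp
      next
        case 2
        then have "P (- z) 0 = 0" using P0 by (simp add: complex_eq_iff)
        from vanish[OF pd(2) this, of x] have "P z x = 2 * p x"
          by (simp add: P_def field_simps)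
        then show ?thesis using 2 by (simp add: algebra_simps)
      next
        case 3
        define q where "q = (\<lambda>x. of_real (1 / (1 + \<rho>)) * P z x)"
        define r where "r = (\<lambda>x. of_real (1 / (1 - \<rho>)) * P (- z) x)"
        have ne: "1 + complex_of_real \<rho> \<noteq> 0" "1 - complex_of_real \<rho> \<noteq> 0"
          using 3 by (auto simp: complex_eq_iff)
        have "q \<in> states" "r \<in> states"
          unfolding q_def r_def states_def
          using pos_def_scale[OF pd(1), of "1 / (1 + \<rho>)"] pos_def_scale[OF pd(2), of "1 / (1 - \<rho>)"]
            3 ne P0 by auto
        moreover have "p = (\<lambda>x. of_real ((1 + \<rho>) / 2) * q x + of_real (1 - (1 + \<rho>) / 2) * r x)"
        proof
          fix x
          have half: "of_real (c / 2) * (of_real (1 / c) * w) = w / 2" if "c \<noteq> 0" for c :: real and w :: complex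
            using that by simp
          have e: "1 - (1 + \<rho>) / 2 = (1 - \<rho>) / 2" by (simp add: field_simps)
          have "of_real ((1 + \<rho>) / 2) * q x = P z x / 2"
            unfolding q_def by (rule half) (use 3 in simp)
          moreover have "of_real (1 - (1 + \<rho>) / 2) * r x = P (- z) x / 2"
            unfolding r_def e by (rule half) (use 3 in simp)
          moreover have "p x = P z x / 2 + P (- z) x / 2"
            by (simp add: P_def field_simps)
          ultimately show "p x = of_real ((1 + \<rho>) / 2) * q x + of_real (1 - (1 + \<rho>) / 2) * r x"
            by (simp only:)
        qed
        moreover have "0 < (1 + \<rho>) / 2" "(1 + \<rho>) / 2 < 1" using 3 by auto
        ultimately have "q = p" using assms unfolding extreme_in_def by blast
        then have "q x = p x" by simp
        then show ?thesis using ne by (simp add: q_def field_simps)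
      qed
    qed
    then show ?thesis by (simp add: P_def \<rho>_def algebra_simps)
  qed
  have mult: "p (x + a) = p x * p a" for x a
  proof -
    have 1: "(p (x + a) + p (x - a)) / 2 = of_real (Re (p a)) * p x"
      using key[of 1 x a] by simp
    have 2: "(\<i> * p (x + a) - \<i> * p (x - a)) / 2 = of_real (- Im (p a)) * p x"
      using key[of "\<i>" x a] by simp
    have "p (x + a) = (p (x + a) + p (x - a)) / 2 - \<i> * ((\<i> * p (x + a) - \<i> * p (x - a)) / 2)"
      by (simp add: field_simps)
    also have "\<dots> = (of_real (Re (p a)) + \<i> * of_real (Im (p a))) * p x"
      unfolding 1 2 by (simp add: algebra_simps)
    finally show ?thesis by (simp add: complex_eq mult.commute flip: complex_eq)
  qed
  have "cmod (p x) = 1" for x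
  proof -
    have "p x * cnj (p x) = 1"
      using mult[of x "- x"] by (simp add: pos_def_minus[OF p(1)] p(2))
    then have "complex_of_real ((cmod (p x))\<^sup>2) = 1"
      unfolding complex_norm_square .
    then have "(cmod (p x))\<^sup>2 = 1" by (simp only: of_real_eq_1_iff)
    then show ?thesis using norm_ge_zero[of "p x"] unfolding power2_eq_1_iff by linarith
  qed
  then show ?thesis using mult by (auto simp: character_def)
qed

lemma continuous_coord [continuous_intros]:
  fixes S :: "('i \<Rightarrow> complex) set"
  shows "continuous_on S (\<lambda>p. p i)"
  by (rule continuous_on_subset[OF continuous_on_product_coordinates]) auto

lemma continuous_on_sum_list [continuous_intros]:
  fixes f :: "'i \<Rightarrow> 'b::topological_space \<Rightarrow> 'c::topological_monoid_add"
  assumes "\<And>y. y \<in> set ys \<Longrightarrow> continuous_on S (f y)"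
  shows "continuous_on S (\<lambda>x. \<Sum>y\<leftarrow>ys. f y x)"
  using assms by (induction ys) (auto intro!: continuous_intros)

lemma closed_states: "closed (states :: ('a::ab_group_add \<Rightarrow> complex) set)"
proof -
  have "continuous_on UNIV (\<lambda>p. pd_form p cs)" for cs :: "(complex \<times> 'a) list"
    unfolding pd_form_def case_prod_unfold by (intro continuous_intros)
  then have "closed {p. \<forall>cs :: (complex \<times> 'a) list. Im (pd_form p cs) = 0 \<and> Re (pd_form p cs) \<ge> 0}"
    by (intro closed_Collect_all closed_Collect_conj closed_Collect_eq closed_Collect_le continuous_intros)
  moreover have "closed {p :: 'a \<Rightarrow> complex. p 0 = 1}"
    by (intro closed_Collect_eq continuous_intros)
  ultimately show ?thesis
    unfolding states_def pos_def_def by (intro closed_Collect_conj)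
qed

lemma compact_unit_bounded_functions: "compact {p :: 'i \<Rightarrow> complex. \<forall>x. cmod (p x) \<le> 1}"
proof -
  have "{p :: 'i \<Rightarrow> complex. \<forall>x. cmod (p x) \<le> 1} = PiE UNIV (\<lambda>_. cball 0 1)"
    by auto
  then show ?thesis
    using compactin_PiE[of "\<lambda>_::'i. euclidean :: complex topology" UNIV "\<lambda>_::'i. cball (0::complex) 1"]
    by (simp add: euclidean_product_topology)
qed

lemma compact_states: "compact (states :: ('a::ab_group_add \<Rightarrow> complex) set)"
proof -
  have "states \<subseteq> {p :: 'a \<Rightarrow> complex. \<forall>x. cmod (p x) \<le> 1}"
    using pos_def_norm_le by (fastforce simp: states_def)
  moreover have "compact ({p :: 'a \<Rightarrow> complex. \<forall>x. cmod (p x) \<le> 1} \<inter> states)"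
    by (rule compact_Int_closed[OF compact_unit_bounded_functions closed_states])
  ultimately show ?thesis by (simp only: inf.absorb2)
qed

text \<open>
  The Krein-Milman argument in the product topology. The points at which \<open>\<Psi>\<close> is maximal form a
  closed face; a minimal closed face inside it exists by compactness. On a minimal face every
  continuous affine function is constant, in particular the real and imaginary parts of all
  coordinates, so the face is a single extreme point.
\<close>

theorem affine_max_at_extreme:
  fixes X :: "('i \<Rightarrow> complex) set" and \<Psi> :: "('i \<Rightarrow> complex) \<Rightarrow> real"
  assumes X: "compact X" "X \<noteq> {}" "closed X" and \<Psi>: "continuous_on UNIV \<Psi>"
    and aff: "\<And>t q r. \<Psi> (\<lambda>x. of_real t * q x + of_real (1 - t) * r x) = t * \<Psi> q + (1 - t) * \<Psi> r"
  obtains p where "extreme_in X p" "\<And>q. q \<in> X \<Longrightarrow> \<Psi> q \<le> \<Psi> p"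
proof -
  define comb where "comb t q r = (\<lambda>x. complex_of_real t * q x + of_real (1 - t) * r x)"
    for t and q r :: "'i \<Rightarrow> complex"
  define face where "face F \<longleftrightarrow> F \<subseteq> X \<and> F \<noteq> {} \<and> closed F \<and>
    (\<forall>q\<in>X. \<forall>r\<in>X. \<forall>t. 0 < t \<and> t < 1 \<and> comb t q r \<in> F \<longrightarrow> q \<in> F \<and> r \<in> F)" for F
  have subface: "\<exists>F'. face F' \<and> F' \<subseteq> F \<and> (\<forall>q\<in>F'. \<forall>r\<in>F. \<phi> r \<le> \<phi> q)"
    if F: "face F" and cont: "continuous_on UNIV \<phi>"
      and aff: "\<And>t q r. \<phi> (comb t q r) = t * \<phi> q + (1 - t) * \<phi> r"
    for F and \<phi> :: "('i \<Rightarrow> complex) \<Rightarrow> real"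
  proof -
    have "compact F" using F X(1) by (metis face_def inf.absorb_iff2 compact_Int_closed)
    then obtain p where p: "p \<in> F" "\<And>r. r \<in> F \<Longrightarrow> \<phi> r \<le> \<phi> p"
      using continuous_attains_sup[of F \<phi>] F continuous_on_subset[OF cont] by (auto simp: face_def)
    define F' where "F' = {q \<in> F. \<phi> q \<ge> \<phi> p}"
    have "closed F'"
      unfolding F'_def using F by (auto simp: face_def intro!: closed_Collect_conj[of "\<lambda>x. x \<in> F", simplified]
          closed_Collect_le cont continuous_intros)
    moreover have "q \<in> F' \<and> r \<in> F'" if "q \<in> X" "r \<in> X" "0 < t" "t < 1" "comb t q r \<in> F'" for q r t
    proof -
      have qr: "q \<in> F" "r \<in> F" using that F by (auto simp: F'_def face_def)
      then have le: "\<phi> q \<le> \<phi> p" "\<phi> r \<le> \<phi> p" using p by auto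
      have "t * \<phi> q + (1 - t) * \<phi> r \<ge> \<phi> p" using that(5) by (simp add: F'_def aff)
      then have sum: "t * (\<phi> p - \<phi> q) + (1 - t) * (\<phi> p - \<phi> r) \<le> 0" by (simp add: algebra_simps)
      have "t * (\<phi> p - \<phi> q) \<ge> 0" "(1 - t) * (\<phi> p - \<phi> r) \<ge> 0" using le that by auto
      with sum have "t * (\<phi> p - \<phi> q) = 0" "(1 - t) * (\<phi> p - \<phi> r) = 0" by linarith+
      with that(3,4) qr show ?thesis by (simp add: F'_def)
    qed
    ultimately have "face F'" using F p(1) unfolding face_def by (auto simp: F'_def)
    then show ?thesis using p(2) by (intro exI[of _ F']) (auto simp: F'_def intro: order_trans)
  qed
  have "face X" using X by (auto simp: face_def)
  from subface[OF this \<Psi>] aff obtain F0 where F0: "face F0" "\<And>q r. q \<in> F0 \<Longrightarrow> r \<in> X \<Longrightarrow> \<Psi> r \<le> \<Psi> q"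
    unfolding comb_def by metis
  (* Complements turn the search for a minimal face into one for a maximal element of A. *)
  define A where "A = {- F | F. face F \<and> F \<subseteq> F0}"
  have "\<exists>M\<in>A. \<forall>U\<in>A. M \<subseteq> U \<longrightarrow> U = M"
  proof (rule subset_Zorn_nonempty)
    show "A \<noteq> {}" using F0 by (auto simp: A_def)
    fix C assume C: "C \<noteq> {}" "subset.chain A C"
    define D where "D = uminus ` C"
    have D: "\<And>F. F \<in> D \<Longrightarrow> face F \<and> F \<subseteq> F0" "D \<noteq> {}"
      using C by (auto simp: D_def A_def subset.chain_def)
    have chain: "F \<subseteq> F' \<or> F' \<subseteq> F" if "F \<in> D" "F' \<in> D" for F F'
      using that C by (auto simp: D_def subset.chain_def)
    have "X \<inter> \<Inter>D \<noteq> {}"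
    proof (rule compact_imp_fip[OF X(1)])
      show "closed T" if "T \<in> D" for T using D(1)[OF that] by (simp add: face_def)
      fix D' assume D': "finite D'" "D' \<subseteq> D"
      show "X \<inter> \<Inter>D' \<noteq> {}"
      proof (cases "D' = {}")
        case False
        have "\<exists>F\<in>D'. F \<subseteq> \<Inter>D'"
          using D'(1) False D'(2)
        proof (induction D' rule: finite_ne_induct)
          case (insert F D')
          then obtain F' where "F' \<in> D'" "F' \<subseteq> \<Inter>D'" by auto
          with chain[of F F'] insert.prems show ?case by auto
        qed auto
        then show ?thesis using D(1) D'(2) by (fastforce simp: face_def)
      qed (use X in auto)
    qed
    then have "face (\<Inter>D)"
      unfolding face_def
    proof (intro conjI)
      obtain F where "F \<in> D" using D(2) by blast
      then show "\<Inter>D \<subseteq> X" using D(1)[of F] by (auto simp: face_def)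
      show "closed (\<Inter>D)" using D by (intro closed_Inter) (auto simp: face_def)
      show "\<forall>q\<in>X. \<forall>r\<in>X. \<forall>t. 0 < t \<and> t < 1 \<and> comb t q r \<in> \<Inter>D \<longrightarrow> q \<in> \<Inter>D \<and> r \<in> \<Inter>D"
        using D(1) unfolding face_def by blast
    qed auto
    moreover have "\<Inter>D \<subseteq> F0" using D by blast
    moreover have "\<Union>C = - \<Inter>D" by (auto simp: D_def)
    ultimately show "\<Union>C \<in> A" unfolding A_def by blast
  qed
  then obtain M where "M \<in> A" and M: "\<And>U. U \<in> A \<Longrightarrow> M \<subseteq> U \<Longrightarrow> U = M" by blast
  then obtain F where F: "face F" "F \<subseteq> F0" "M = - F" by (auto simp: A_def)
  have min: "F' = F" if "face F'" "F' \<subseteq> F" for F'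
    using M[of "- F'"] that F by (auto simp: A_def)
  have const: "\<phi> q = \<phi> r"
    if qr: "q \<in> F" "r \<in> F" and cont: "continuous_on UNIV \<phi>" and aff: "\<And>t q r. \<phi> (comb t q r) = t * \<phi> q + (1 - t) * \<phi> r"
    for \<phi> :: "('i \<Rightarrow> complex) \<Rightarrow> real" and q r
  proof -
    obtain F' where F': "face F'" "F' \<subseteq> F" "\<forall>q\<in>F'. \<forall>r\<in>F. \<phi> r \<le> \<phi> q"
      using subface[OF F(1) cont aff] by blast
    with min qr show ?thesis by (metis order_antisym)
  qed
  have single: "q = r" if "q \<in> F" "r \<in> F" for q r
  proof
    fix x
    have "Re (q x) = Re (r x)" "Im (q x) = Im (r x)"
      using that by (auto intro!: const[of q r "\<lambda>p. Re (p x)"] const[of q r "\<lambda>p. Im (p x)"]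
          continuous_intros simp: comb_def)
    then show "q x = r x" by (rule complex_eqI)
  qed
  obtain p where p: "p \<in> F" using F(1) by (auto simp: face_def)
  show thesis
  proof (rule that[of p])
    show "\<Psi> q \<le> \<Psi> p" if "q \<in> X" for q using F0(2) F(2) p that by blast
    have "q = p" if "q \<in> X" "r \<in> X" "0 < t" "t < 1" "p = comb t q r" for q r t
    proof -
      have "q \<in> F" using F(1) p that unfolding face_def by blast
      then show ?thesis using single p by blast
    qed
    moreover have "p \<in> X" using F(1) p by (auto simp: face_def)
    ultimately show "extreme_in X p" unfolding extreme_in_def comb_def by blast
  qed
qed

section \<open>Characters correlated with a given function\<close>

definition mean :: "('a::ab_group_add \<Rightarrow> real) \<Rightarrow> real" where
  "mean f = (SOME m. has_mean f m)"

lemma has_mean_mean: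
  fixes f :: "'a::topological_ab_group_add \<Rightarrow> real"
  assumes "compact (UNIV :: 'a set)" "continuous_on UNIV f"
  shows "has_mean f (mean f)"
  unfolding mean_def using has_mean_exists[OF assms] by (metis someI_ex)

definition autocorr :: "('a::ab_group_add \<Rightarrow> real) \<Rightarrow> 'a \<Rightarrow> real" where
  "autocorr f y = mean (\<lambda>x. f x * f (x + y))"

lemma autocorr_has_mean:
  fixes f :: "'a::topological_ab_group_add \<Rightarrow> real"
  assumes "compact (UNIV :: 'a set)" and f: "continuous_on UNIV f"
  shows "has_mean (\<lambda>x. f (x + y) * f (x + w)) (autocorr f (y - w))"
proof -
  have "has_mean (\<lambda>x. f x * f (x + (y - w))) (autocorr f (y - w))"
    unfolding autocorr_def
    by (intro has_mean_mean assms continuous_intros continuous_on_compose2[OF f]) auto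
  from has_mean_translate[OF this, of w] show ?thesis
    by (simp add: add_ac mult.commute)
qed

lemma sum_list_product:
  fixes F :: "'i \<Rightarrow> complex"
  shows "(\<Sum>i\<leftarrow>xs. F i) * (\<Sum>j\<leftarrow>ys. G j) = (\<Sum>i\<leftarrow>xs. \<Sum>j\<leftarrow>ys. F i * G j)"
  by (simp add: sum_list_mult_const sum_list_const_mult)

text \<open>
  The form of the autocorrelation is the mean of a square modulus: this yields both its positive
  definiteness and, for coefficients taken from a character, the meaning of \<open>correlation\<close> below.
\<close>

lemma pd_form_autocorr_mean:
  fixes f :: "'a::topological_ab_group_add \<Rightarrow> real"
  assumes "compact (UNIV :: 'a set)" "continuous_on UNIV f"
  shows "has_mean (\<lambda>x. complex_of_real ((cmod (\<Sum>(c, y)\<leftarrow>cs. c * of_real (f (x + y))))\<^sup>2))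
           (pd_form (\<lambda>y. of_real (autocorr f y)) cs)"
proof -
  have "complex_of_real ((cmod (\<Sum>(c, y)\<leftarrow>cs. c * of_real (f (x + y))))\<^sup>2)
      = (\<Sum>(c, y)\<leftarrow>cs. \<Sum>(d, w)\<leftarrow>cs. c * cnj d * of_real (f (x + y) * f (x + w)))" for x
    unfolding complex_norm_square sum_list_linear[OF bounded_linear.linear[OF bounded_linear_cnj]]
      sum_list_product case_prod_unfold
    by (simp add: mult_ac)
  moreover have "has_mean (\<lambda>x. \<Sum>(c, y)\<leftarrow>cs. \<Sum>(d, w)\<leftarrow>cs. c * cnj d * of_real (f (x + y) * f (x + w)))
      (pd_form (\<lambda>y. of_real (autocorr f y)) cs)"
    unfolding pd_form_def case_prod_unfold
    by (intro has_mean_sum_list has_mean_linear[where h = "\<lambda>r. c * of_real r" for c] autocorr_has_mean assms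
        bounded_linear_compose[OF bounded_linear_mult_right bounded_linear_of_real])
  ultimately show ?thesis by simp
qed

lemma pd_form_autocorr:
  fixes f :: "'a::topological_ab_group_add \<Rightarrow> real"
  assumes cpt: "compact (UNIV :: 'a set)" and f: "continuous_on UNIV f"
  defines "g \<equiv> \<lambda>y. complex_of_real (autocorr f y)"
  shows "has_mean (\<lambda>x. (cmod (\<Sum>(c, y)\<leftarrow>cs. c * of_real (f (x + y))))\<^sup>2) (Re (pd_form g cs))"
    and "Im (pd_form g cs) = 0"
proof -
  let ?S = "\<lambda>x. (cmod (\<Sum>(c, y)\<leftarrow>cs. c * of_real (f (x + y))))\<^sup>2"
  have "continuous_on UNIV ?S"
    unfolding case_prod_unfold
    by (intro continuous_intros continuous_on_compose2[OF f]) auto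
  then obtain m where m: "has_mean ?S m"
    using has_mean_exists[OF cpt] by blast
  have "pd_form g cs = of_real m"
    using has_mean_unique[OF pd_form_autocorr_mean[OF cpt f] has_mean_linear[OF bounded_linear_of_real m]]
    unfolding g_def .
  with m show "has_mean ?S (Re (pd_form g cs))" "Im (pd_form g cs) = 0" by simp_all
qed

lemma pos_def_autocorr:
  fixes f :: "'a::topological_ab_group_add \<Rightarrow> real"
  assumes "compact (UNIV :: 'a set)" "continuous_on UNIV f"
  shows "pos_def (\<lambda>y. complex_of_real (autocorr f y))"
  unfolding pos_def_def
  using pd_form_autocorr[OF assms] has_mean_mono[OF has_mean_const pd_form_autocorr(1)[OF assms], of 0]
  by simp

lemma character_0: "character \<xi> \<Longrightarrow> \<xi> 0 = 1"
  unfolding character_def by (metis add.right_neutral mult_cancel_left2 norm_eq_zero zero_neq_one)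

lemma character_add: "character \<xi> \<Longrightarrow> \<xi> (x + y) = \<xi> x * \<xi> y"
  by (simp add: character_def)

lemma character_norm: "character \<xi> \<Longrightarrow> cmod (\<xi> x) = 1"
  by (simp add: character_def)

lemma character_cnj: "character \<xi> \<Longrightarrow> \<xi> x * cnj (\<xi> x) = 1"
  by (metis character_norm complex_norm_square of_real_1 one_power2)

lemma character_minus:
  assumes "character \<xi>"
  shows "\<xi> (- x) = cnj (\<xi> x)"
proof -
  have "\<xi> (- x) = \<xi> (- x) * (\<xi> x * cnj (\<xi> x))" using character_cnj[OF assms] by simp
  also have "\<dots> = \<xi> (- x + x) * cnj (\<xi> x)" unfolding character_add[OF assms] by simp
  finally show ?thesis by (simp add: character_0[OF assms])
qed

lemma character_diff: "character \<xi> \<Longrightarrow> \<xi> (x - y) = \<xi> x * cnj (\<xi> y)"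
  using character_add[of \<xi> x "- y"] by (simp add: character_minus)

text \<open>
  At a character \<open>\<xi>\<close> this is the mean square of the average over \<open>L\<close> of \<open>f\<close> times the conjugate of
  \<open>\<xi>\<close>, an upper bound for the squared modulus of a Fourier coefficient. As a function of \<open>p\<close> it is
  affine and continuous for pointwise convergence, which makes it accessible to extreme point
  arguments.
\<close>

definition correlation :: "('a::ab_group_add \<Rightarrow> real) \<Rightarrow> 'a list \<Rightarrow> ('a \<Rightarrow> complex) \<Rightarrow> real" where
  "correlation f L p =
     Re (\<Sum>a\<leftarrow>L. \<Sum>b\<leftarrow>L. of_real (autocorr f (a - b)) * p (b - a)) / (real (length L))\<^sup>2"

definition twist :: "('a \<Rightarrow> real) \<Rightarrow> ('a \<Rightarrow> complex) \<Rightarrow> 'a \<Rightarrow> complex" where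
  "twist f \<xi> x = of_real (f x) * cnj (\<xi> x)"

lemma correlation_character:
  fixes f :: "'a::topological_ab_group_add \<Rightarrow> real"
  assumes cpt: "compact (UNIV :: 'a set)" and f: "continuous_on UNIV f" and \<xi>: "character \<xi>"
  shows "has_mean (\<lambda>x. (cmod (avg L (twist f \<xi>) x))\<^sup>2) (correlation f L \<xi>)"
proof -
  define n where "n = real (length L)"
  define cs where "cs = map (\<lambda>a. (cnj (\<xi> a) / of_real n, a)) L"
  have "avg L (twist f \<xi>) x = cnj (\<xi> x) * (\<Sum>(c, y)\<leftarrow>cs. c * of_real (f (x + y)))" for x
    unfolding cs_def avg_def twist_def n_def scaleR_sum_list sum_list_const_mult[symmetric]
    by (simp add: o_def character_add[OF \<xi>] scaleR_conv_of_real divide_inverse mult_ac)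
  then have "(cmod (avg L (twist f \<xi>) x))\<^sup>2 = (cmod (\<Sum>(c, y)\<leftarrow>cs. c * of_real (f (x + y))))\<^sup>2" for x
    by (simp add: norm_mult character_norm[OF \<xi>])
  moreover have "Re (pd_form (\<lambda>y. of_real (autocorr f y)) cs) = correlation f L \<xi>"
  proof -
    have "pd_form (\<lambda>y. of_real (autocorr f y)) cs =
        of_real (inverse (n\<^sup>2)) * (\<Sum>a\<leftarrow>L. \<Sum>b\<leftarrow>L. of_real (autocorr f (a - b)) * \<xi> (b - a))"
      unfolding pd_form_def cs_def sum_list_const_mult[symmetric]
      by (simp add: o_def character_diff[OF \<xi>] power2_eq_square divide_inverse mult_ac)
    then show ?thesis unfolding correlation_def n_def[symmetric]
      by (simp add: divide_inverse del: of_real_inverse of_real_power)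
  qed
  ultimately show ?thesis using pd_form_autocorr(1)[OF cpt f, of cs] by simp
qed

text \<open>
  Convexity of the square modulus, through the tangent \<open>2 * Re (z * cnj m) - (cmod m)\<^sup>2\<close> at the
  average \<open>m\<close>.
\<close>

lemma cmod_avg_squared_le:
  assumes "K \<noteq> []"
  shows "(cmod (avg K h x))\<^sup>2 \<le> avg K (\<lambda>x. (cmod (h x))\<^sup>2) x"
proof -
  define m where "m = avg K h x"
  define \<phi> where "\<phi> z = 2 * Re (z * cnj m)" for z
  have lin: "linear \<phi>" unfolding \<phi>_def
    by (intro linearI) (simp_all add: algebra_simps)
  have re: "Re (z * cnj z) = (cmod z)\<^sup>2" for z
    unfolding complex_norm_square[symmetric] by simp
  have le: "\<phi> z - (cmod m)\<^sup>2 \<le> (cmod z)\<^sup>2" for z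
  proof -
    have "0 \<le> (cmod (z - m))\<^sup>2" by simp
    then show ?thesis unfolding re[symmetric] by (simp add: \<phi>_def algebra_simps)
  qed
  have "avg K (\<lambda>y. \<phi> (h y) - (cmod m)\<^sup>2) x \<le> avg K (\<lambda>y. (cmod (h y))\<^sup>2) x"
    by (rule avg_mono) (rule le)
  moreover have "\<phi> m = 2 * (cmod m)\<^sup>2" unfolding \<phi>_def re ..
  ultimately show ?thesis
    by (simp add: avg_diff avg_linear[OF lin] avg_const[OF assms] flip: m_def)
qed

lemma correlation_refine:
  fixes f :: "'a::topological_ab_group_add \<Rightarrow> real"
  assumes cpt: "compact (UNIV :: 'a set)" and f: "continuous_on UNIV f" and \<xi>: "character \<xi>"
    and "K \<noteq> []"
  shows "correlation f (list_plus K L) \<xi> \<le> correlation f L \<xi>"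
proof (rule has_mean_mono[OF correlation_character[OF cpt f \<xi>]
      has_mean_avg[OF correlation_character[OF cpt f \<xi>] \<open>K \<noteq> []\<close>]])
  show "(cmod (avg (list_plus K L) (twist f \<xi>) x))\<^sup>2 \<le> avg K (\<lambda>x. (cmod (avg L (twist f \<xi>) x))\<^sup>2) x" for x
    unfolding avg_avg[symmetric] by (rule cmod_avg_squared_le) fact
qed

lemma list_plus_commute_correlation:
  fixes f :: "'a::topological_ab_group_add \<Rightarrow> real"
  assumes cpt: "compact (UNIV :: 'a set)" and f: "continuous_on UNIV f" and \<xi>: "character \<xi>"
  shows "correlation f (list_plus K L) \<xi> = correlation f (list_plus L K) \<xi>"
proof (rule has_mean_unique[OF correlation_character[OF cpt f \<xi>]])
  show "has_mean (\<lambda>x. (cmod (avg (list_plus K L) (twist f \<xi>) x))\<^sup>2) (correlation f (list_plus L K) \<xi>)"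
    unfolding avg_avg[symmetric] avg_commute[of K]
    unfolding avg_avg by (rule correlation_character[OF cpt f \<xi>])
qed

text \<open>
  If \<open>n\<close> objects are put into \<open>k\<close> classes, at least \<open>n\<^sup>2 / k\<close> pairs lie in a common class:
  Cauchy-Schwarz for the class sizes.
\<close>

lemma pigeonhole_pairs:
  assumes "finite C" "\<kappa> ` set L \<subseteq> C"
  shows "(real (length L))\<^sup>2 \<le> (\<Sum>a\<leftarrow>L. \<Sum>b\<leftarrow>L. of_bool (\<kappa> a = \<kappa> b) :: real) * card C"
proof -
  define N :: "_ \<Rightarrow> real" where "N c = (\<Sum>a\<leftarrow>L. of_bool (\<kappa> a = c))" for c
  have swap: "(\<Sum>c\<in>C. \<Sum>a\<leftarrow>K. F c a) = (\<Sum>a\<leftarrow>K. \<Sum>c\<in>C. F c a)" for F :: "_ \<Rightarrow> _ \<Rightarrow> real" and K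
    by (induction K) (auto simp: sum.distrib)
  have one: "(\<Sum>c\<in>C. of_bool (\<kappa> a = c)) = (1 :: real)" if "a \<in> set L" for a
  proof -
    have "\<kappa> a \<in> C" using that assms(2) by blast
    then show ?thesis using assms(1) by (simp add: of_bool_def)
  qed
  have "(\<Sum>c\<in>C. N c) = real (length L)"
    unfolding N_def swap using one by (simp add: sum_list_triv cong: map_cong)
  moreover have "(\<Sum>c\<in>C. (N c)\<^sup>2) = (\<Sum>a\<leftarrow>L. \<Sum>b\<leftarrow>L. of_bool (\<kappa> a = \<kappa> b))"
  proof -
    have "(\<Sum>c\<in>C. (N c)\<^sup>2) = (\<Sum>a\<leftarrow>L. \<Sum>b\<leftarrow>L. \<Sum>c\<in>C. of_bool (\<kappa> a = c) * of_bool (\<kappa> b = c))"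
      unfolding N_def power2_eq_square sum_list_mult_const[symmetric] sum_list_const_mult[symmetric] swap by (simp add: mult.commute)
    also have "(\<Sum>c\<in>C. of_bool (\<kappa> a = c) * of_bool (\<kappa> b = c)) = (of_bool (\<kappa> a = \<kappa> b) :: real)"
      if "a \<in> set L" for a b
    proof -
      have "(\<Sum>c\<in>C. of_bool (\<kappa> a = c) * of_bool (\<kappa> b = c)) =
          (\<Sum>c\<in>C. of_bool (\<kappa> a = \<kappa> b) * of_bool (\<kappa> a = c) :: real)"
        by (intro sum.cong) auto
      then show ?thesis using one[OF that] by (simp flip: sum_distrib_left)
    qed
    then have "(\<Sum>a\<leftarrow>L. \<Sum>b\<leftarrow>L. \<Sum>c\<in>C. of_bool (\<kappa> a = c) * of_bool (\<kappa> b = c)) =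
        (\<Sum>a\<leftarrow>L. \<Sum>b\<leftarrow>L. of_bool (\<kappa> a = \<kappa> b) :: real)"
      by (intro arg_cong[of _ _ sum_list] map_cong refl) auto
    finally show ?thesis .
  qed
  ultimately show ?thesis using sum_squared_le_sum_of_squares[of N C] by simp
qed

text \<open>
  The normalised autocorrelation is correlated with \<open>f\<close> uniformly in \<open>L\<close>. Indeed the
  autocorrelation is at least half its value at \<open>0\<close> on differences of two points of some
  neighbourhood \<open>V\<close> of \<open>0\<close>. If \<open>k\<close> translates of \<open>V\<close> cover the group, then a \<open>k\<close>-th part of all
  pairs \<open>(a, b)\<close> from \<open>L\<close> lie in a common translate, and each of them contributes at least a
  quarter of the value at \<open>0\<close>. The number \<open>k\<close> does not depend on \<open>L\<close>; here compactness of the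
  group enters in an essential way.
\<close>

lemma autocorr_correlation_bound:
  fixes f :: "'a::topological_ab_group_add \<Rightarrow> real"
  assumes cpt: "compact (UNIV :: 'a set)" and f: "continuous_on UNIV f" and "f a \<noteq> 0"
  obtains c where "c > 0" "(\<lambda>x. of_real (autocorr f x / autocorr f 0)) \<in> states"
    "\<And>L. L \<noteq> [] \<Longrightarrow> c \<le> correlation f L (\<lambda>x. of_real (autocorr f x / autocorr f 0))"
proof -
  define g where "g = autocorr f"
  have mean: "has_mean (\<lambda>x. f (x + y) * f (x + w)) (g (y - w))" for y w
    unfolding g_def by (rule autocorr_has_mean[OF cpt f])
  have pd: "pos_def (\<lambda>y. complex_of_real (g y))"
    unfolding g_def by (rule pos_def_autocorr[OF cpt f])
  have g0: "g 0 > 0"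
  proof (rule has_mean_pos[OF cpt _ _ _ mean[of 0 0, simplified]])
    show "continuous_on UNIV (\<lambda>x. f x * f x)" by (intro continuous_intros f)
    show "f a * f a > 0" using \<open>f a \<noteq> 0\<close> by (metis not_real_square_gt_zero)
  qed auto
  have even: "g (- y) = g y" for y
    using pos_def_minus[OF pd, of y] by simp
  have state: "(\<lambda>x. of_real (g x / g 0)) \<in> states"
    using pos_def_scale[OF pd, of "1 / g 0"] g0 by (simp add: states_def)
  obtain B0 where B0: "\<And>x. norm (f x) \<le> B0"
    using compact_imp_bounded[OF compact_continuous_image[OF f cpt]] unfolding bounded_iff by blast
  define B where "B = max B0 1"
  have B: "B > 0" "\<And>x. \<bar>f x\<bar> \<le> B" using B0 by (auto simp: B_def le_max_iff_disj)
  define d where "d = g 0 / (4 * B)"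
  have "d > 0" using g0 B by (simp add: d_def)
  obtain V where V: "open V" "0 \<in> V" "\<And>x v. v \<in> V \<Longrightarrow> dist (f (x + v)) (f x) < d"
    using uniformly_small_shift[OF cpt f \<open>d > 0\<close>] by blast
  have near: "g (v - w) \<ge> g 0 / 2" if "v \<in> V" "w \<in> V" for v w
  proof -
    have "f x * f x - 2 * B * d \<le> f (x + v) * f (x + w)" for x
    proof -
      have "\<bar>f x * f x - f (x + v) * f (x + w)\<bar> = \<bar>f x * (f x - f (x + w)) + f (x + w) * (f x - f (x + v))\<bar>"
        by (simp add: algebra_simps)
      also have "\<dots> \<le> \<bar>f x\<bar> * \<bar>f x - f (x + w)\<bar> + \<bar>f (x + w)\<bar> * \<bar>f x - f (x + v)\<bar>"
        unfolding abs_mult[symmetric] by (rule abs_triangle_ineq)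
      also have "\<dots> \<le> B * d + B * d"
        using V(3)[OF that(1), of x] V(3)[OF that(2), of x] B \<open>d > 0\<close>
        by (intro add_mono mult_mono) (auto simp: dist_real_def abs_minus_commute less_imp_le)
      finally show ?thesis by linarith
    qed
    moreover have "has_mean (\<lambda>x. f x * f x - 2 * B * d) (g 0 - 2 * B * d)"
      using has_mean_add[OF mean[of 0 0] has_mean_const[of "- (2 * B * d)"]] by simp
    ultimately have "g 0 - 2 * B * d \<le> g (v - w)" using has_mean_mono[OF _ mean] by blast
    then show ?thesis using B by (simp add: d_def)
  qed
  obtain K where K: "K \<noteq> []" "\<And>x. \<exists>h\<in>set K. x - h \<in> V"
    using finite_translates_cover[OF cpt V(1,2)] by blast
  obtain \<kappa> where \<kappa>: "\<And>x. \<kappa> x \<in> set K" "\<And>x. x - \<kappa> x \<in> V" using K(2) by metis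
  define k where "k = real (card (set K))"
  have "k > 0" using K(1) by (simp add: k_def card_gt_0_iff)
  have bound: "g 0 / (4 * k) \<le> correlation f L (\<lambda>x. of_real (g x / g 0))" if "L \<noteq> []" for L
  proof -
    have entry: "g 0 / 4 * of_bool (\<kappa> a = \<kappa> b) \<le> g (a - b) * (g (b - a) / g 0)" for a b
    proof -
      have eq: "g (a - b) * (g (b - a) / g 0) = (g (a - b))\<^sup>2 / g 0"
        using even[of "a - b"] by (simp add: power2_eq_square)
      show ?thesis
      proof (cases "\<kappa> a = \<kappa> b")
        case True
        have "g (a - b) \<ge> g 0 / 2" using near[OF \<kappa>(2) \<kappa>(2), of a b] True by simp
        then have "(g 0 / 2)\<^sup>2 \<le> (g (a - b))\<^sup>2" using g0 by (intro power_mono) auto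
        then have "(g 0 / 2)\<^sup>2 / g 0 \<le> (g (a - b))\<^sup>2 / g 0" using g0 by (intro divide_right_mono) auto
        then show ?thesis unfolding eq using True g0 by (simp add: power2_eq_square)
      next
        case False
        then show ?thesis unfolding eq using g0 by simp
      qed
    qed
    define n where "n = real (length L)"
    have "n > 0" using that by (simp add: n_def)
    have "n\<^sup>2 \<le> (\<Sum>a\<leftarrow>L. \<Sum>b\<leftarrow>L. of_bool (\<kappa> a = \<kappa> b)) * k"
      unfolding n_def k_def by (rule pigeonhole_pairs) (use \<kappa> in auto)
    then have "g 0 / (4 * k) * n\<^sup>2 \<le> g 0 / (4 * k) * ((\<Sum>a\<leftarrow>L. \<Sum>b\<leftarrow>L. of_bool (\<kappa> a = \<kappa> b)) * k)"
      using g0 \<open>k > 0\<close> by (intro mult_left_mono) auto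
    also have "\<dots> = (\<Sum>a\<leftarrow>L. \<Sum>b\<leftarrow>L. g 0 / 4 * of_bool (\<kappa> a = \<kappa> b))"
      unfolding sum_list_const_mult using \<open>k > 0\<close> by simp
    also have "\<dots> \<le> (\<Sum>a\<leftarrow>L. \<Sum>b\<leftarrow>L. g (a - b) * (g (b - a) / g 0))"
      by (intro sum_list_mono entry)
    also have "\<dots> = Re (\<Sum>a\<leftarrow>L. \<Sum>b\<leftarrow>L. of_real (g (a - b)) * of_real (g (b - a) / g 0))"
      by (simp add: sum_list_linear[OF bounded_linear.linear[OF bounded_linear_Re]])
    finally show ?thesis
      unfolding correlation_def g_def[symmetric] n_def[symmetric]
      using \<open>n > 0\<close> by (simp add: pos_le_divide_eq)
  qed
  show thesis
    using that[of "g 0 / (4 * k)"] bound state g0 \<open>k > 0\<close> unfolding g_def by simp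
qed

text \<open>
  For a single \<open>L\<close> an extreme state that maximises \<open>correlation f L\<close> is a character, not
  necessarily continuous, at which the bound of \<open>autocorr_correlation_bound\<close> still holds. Refining
  \<open>L\<close> lowers the correlation of characters, so the closed sets of characters that satisfy the
  bound for \<open>L\<close> have the finite intersection property, and one character serves all \<open>L\<close>.
\<close>

theorem correlated_character:
  fixes f :: "'a::topological_ab_group_add \<Rightarrow> real"
  assumes cpt: "compact (UNIV :: 'a set)" and f: "continuous_on UNIV f" and "f a \<noteq> 0"
  obtains \<xi> c where "character \<xi>" "c > 0"
    "\<And>L. L \<noteq> [] \<Longrightarrow> \<exists>x. c \<le> cmod (avg L (twist f \<xi>) x)"
proof -
  obtain c where c: "c > 0" and state: "(\<lambda>x. of_real (autocorr f x / autocorr f 0)) \<in> states"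
    and bound: "\<And>L. L \<noteq> [] \<Longrightarrow> c \<le> correlation f L (\<lambda>x. of_real (autocorr f x / autocorr f 0))"
    using autocorr_correlation_bound[OF cpt f \<open>f a \<noteq> 0\<close>] by blast
  have cont: "continuous_on S (correlation f L)" for L S
    unfolding correlation_def divide_inverse
    by (intro continuous_intros)
  have aff: "correlation f L (\<lambda>x. of_real t * q x + of_real (1 - t) * r x)
      = t * correlation f L q + (1 - t) * correlation f L r" for L t q r
  proof -
    have "(\<Sum>a\<leftarrow>L. \<Sum>b\<leftarrow>L. of_real (autocorr f (a - b)) * (of_real t * q (b - a) + of_real (1 - t) * r (b - a)))
      = of_real t * (\<Sum>a\<leftarrow>L. \<Sum>b\<leftarrow>L. of_real (autocorr f (a - b)) * q (b - a))
      + of_real (1 - t) * (\<Sum>a\<leftarrow>L. \<Sum>b\<leftarrow>L. of_real (autocorr f (a - b)) * r (b - a))"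
      unfolding sum_list_const_mult[symmetric] sum_list_addf[symmetric]
      by (simp add: algebra_simps)
    then show ?thesis
      unfolding correlation_def by (simp add: add_divide_distrib)
  qed
  have single: "\<exists>\<xi>. character \<xi> \<and> c \<le> correlation f L \<xi>" if "L \<noteq> []" for L
  proof -
    obtain p where p: "extreme_in states p" "\<And>q. q \<in> states \<Longrightarrow> correlation f L q \<le> correlation f L p"
      using affine_max_at_extreme[OF compact_states _ closed_states cont aff, of L] state by blast
    then show ?thesis using extreme_state_character[OF p(1)] bound[OF that] p(2)[OF state] by force
  qed
  define X where "X L = {\<xi>. character \<xi> \<and> c \<le> correlation f L \<xi>}" for L
  have closed: "closed (X L)" for L
    unfolding X_def character_def
    by (intro closed_Collect_conj closed_Collect_all closed_Collect_eq closed_Collect_le cont continuous_intros)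
  have "{p. \<forall>x. cmod (p x) \<le> 1} \<inter> (\<Inter>L\<in>- {[]}. X L) \<noteq> {}"
  proof (rule compact_imp_fip_image[OF compact_unit_bounded_functions closed])
    fix I :: "'a list set" assume I: "finite I" "I \<subseteq> - {[]}"
    have "\<exists>K. K \<noteq> [] \<and> (\<forall>L\<in>I. \<forall>\<xi>. character \<xi> \<longrightarrow> correlation f K \<xi> \<le> correlation f L \<xi>)"
      using I
    proof (induction I)
      case empty
      then show ?case by (auto intro!: exI[of _ "[0]"])
    next
      case (insert L I)
      then obtain K where K: "K \<noteq> []" "\<And>L \<xi>. L \<in> I \<Longrightarrow> character \<xi> \<Longrightarrow> correlation f K \<xi> \<le> correlation f L \<xi>"
        by auto
      have "correlation f (list_plus K L) \<xi> \<le> correlation f L' \<xi>" if "L' \<in> insert L I" "character \<xi>" for L' \<xi>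
        using that correlation_refine[OF cpt f that(2) K(1), of L] K(2)[of L' \<xi>]
          correlation_refine[OF cpt f that(2), of L K] insert.prems
          list_plus_commute_correlation[OF cpt f that(2), of K L] by fastforce
      moreover have "list_plus K L \<noteq> []" using K(1) insert.prems by auto
      ultimately show ?case by blast
    qed
    then obtain K where K: "K \<noteq> []" "\<And>L \<xi>. L \<in> I \<Longrightarrow> character \<xi> \<Longrightarrow> correlation f K \<xi> \<le> correlation f L \<xi>"
      by blast
    obtain \<xi> where "character \<xi>" "c \<le> correlation f K \<xi>" using single[OF K(1)] by blast
    then have "\<xi> \<in> {p. \<forall>x. cmod (p x) \<le> 1} \<inter> (\<Inter>L\<in>I. X L)"
      using K(2) unfolding X_def by (auto simp: character_norm intro: order_trans)
    then show "{p. \<forall>x. cmod (p x) \<le> 1} \<inter> (\<Inter>L\<in>I. X L) \<noteq> {}" by blast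
  qed
  then obtain \<xi> where \<xi>: "\<And>L. L \<noteq> [] \<Longrightarrow> \<xi> \<in> X L" by blast
  from \<xi>[of "[0]"] have char: "character \<xi>" by (simp add: X_def)
  have "\<exists>x. sqrt (c / 2) \<le> cmod (avg L (twist f \<xi>) x)" if "L \<noteq> []" for L
  proof (rule ccontr)
    assume "\<not> ?thesis"
    then have "(cmod (avg L (twist f \<xi>) x))\<^sup>2 \<le> c / 2" for x
      using c by (metis less_imp_le not_le real_sqrt_le_iff real_sqrt_abs abs_norm_cancel)
    then have "correlation f L \<xi> \<le> c / 2"
      by (rule has_mean_mono[OF correlation_character[OF cpt f char] has_mean_const])
    moreover have "c \<le> correlation f L \<xi>" using \<xi>[OF that] by (simp add: X_def)
    ultimately show False using c by simp
  qed
  then show thesis using that[OF char, of "sqrt (c / 2)"] c by simp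
qed

section \<open>Continuous characters separate closed subgroups from points\<close>

primrec nmul :: "nat \<Rightarrow> 'a::monoid_add \<Rightarrow> 'a" where
  "nmul 0 z = 0"
| "nmul (Suc n) z = nmul n z + z"

definition multiples :: "'a::monoid_add \<Rightarrow> nat \<Rightarrow> 'a list" where
  "multiples z n = map (\<lambda>j. nmul j z) [0..<n]"

lemma multiples_eq_Nil_iff [simp]: "multiples z n = [] \<longleftrightarrow> n = 0"
  by (simp add: multiples_def)

text \<open>
  The two averages share all but one summand each: this is why averages over multiples of \<open>z\<close> are
  almost invariant under translation by \<open>z\<close>.
\<close>

lemma avg_multiples_shift:
  fixes h :: "'a::ab_group_add \<Rightarrow> 'b::real_normed_vector"
  assumes "\<And>x. norm (h x) \<le> B"
  shows "norm (avg (multiples z n) h (x + z) - avg (multiples z n) h x) \<le> 2 * B / n"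
proof -
  have "(\<Sum>g\<leftarrow>multiples z n. h (x + z + g)) - (\<Sum>g\<leftarrow>multiples z n. h (x + g)) = h (x + nmul n z) - h x"
    by (induction n) (auto simp: multiples_def algebra_simps)
  then have "avg (multiples z n) h (x + z) - avg (multiples z n) h x = (h (x + nmul n z) - h x) /\<^sub>R n"
    unfolding avg_def scaleR_diff_right[symmetric] by (simp add: multiples_def)
  moreover have "norm (h (x + nmul n z) - h x) \<le> 2 * B"
    using norm_triangle_ineq4[of "h (x + nmul n z)" "h x"] assms[of x] assms[of "x + nmul n z"] by linarith
  ultimately show ?thesis
    by (simp add: divide_inverse mult.commute mult_left_mono)
qed

lemma le_of_le_plus_inverse:
  fixes a b C :: real
  assumes "\<And>n. n > 0 \<Longrightarrow> a \<le> b + C / real n"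
  shows "a \<le> b"
proof (rule LIMSEQ_le_const)
  show "(\<lambda>n. b + C / real n) \<longlonglongrightarrow> b"
    using tendsto_add[OF tendsto_const lim_const_over_n, of b C] by simp
  show "\<exists>N. \<forall>n\<ge>N. a \<le> b + C / real n"
    using assms by (auto intro!: exI[of _ 1])
qed

lemma twist_bound:
  assumes "character \<xi>" "\<And>x. \<bar>f x\<bar> \<le> B"
  shows "cmod (twist f \<xi> x) \<le> B"
  using assms by (simp add: twist_def norm_mult character_norm)

text \<open>
  A character that is correlated with \<open>f\<close> moves no faster than \<open>f\<close>. Let \<open>A\<close> be the average of the
  twisted function over multiples of \<open>z\<close>. Then \<open>A (x + z)\<close> is almost \<open>A x\<close> by telescoping, and
  \<open>\<xi> z * A (x + z)\<close> is within \<open>d\<close> of \<open>A x\<close>, because the translation changes \<open>f\<close> by at most \<open>d\<close>;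
  finally \<open>A\<close> has modulus at least \<open>c\<close> somewhere. This gives continuity of \<open>\<xi>\<close> and shows that \<open>\<xi>\<close>
  is \<open>1\<close> on all periods of \<open>f\<close>.
\<close>

lemma correlated_character_near_1:
  fixes f :: "'a::ab_group_add \<Rightarrow> real"
  assumes \<xi>: "character \<xi>" and corr: "\<And>L. L \<noteq> [] \<Longrightarrow> \<exists>x. c \<le> cmod (avg L (twist f \<xi>) x)"
    and B: "\<And>x. \<bar>f x\<bar> \<le> B" and d: "\<And>x. \<bar>f (x + z) - f x\<bar> \<le> d"
  shows "cmod (\<xi> z - 1) * c \<le> d"
proof (rule le_of_le_plus_inverse)
  fix n :: nat assume "n > 0"
  define A where "A = avg (multiples z n) (twist f \<xi>)"
  have ne: "multiples z n \<noteq> []" using \<open>n > 0\<close> by simp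
  obtain x where x: "c \<le> cmod (A x)"
    using corr[OF ne] unfolding A_def by blast
  have "\<xi> z * twist f \<xi> (x + z) - twist f \<xi> x = of_real (f (x + z) - f x) * cnj (\<xi> x)" for x
    using character_cnj[OF \<xi>, of z] by (simp add: twist_def character_add[OF \<xi>] algebra_simps)
  then have "cmod (avg (multiples z n) (\<lambda>x. \<xi> z * twist f \<xi> (x + z) - twist f \<xi> x) x) \<le> d"
    using d by (intro norm_avg_le ne) (simp add: norm_mult character_norm[OF \<xi>] del: of_real_diff)
  moreover have "avg (multiples z n) (\<lambda>x. \<xi> z * twist f \<xi> (x + z) - twist f \<xi> x) x = \<xi> z * A (x + z) - A x"
    unfolding A_def avg_diff
    using avg_linear[OF bounded_linear.linear[OF bounded_linear_mult_right], of "multiples z n" "\<xi> z" "\<lambda>x. twist f \<xi> (x + z)"]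
    by (simp add: avg_translate)
  ultimately have "cmod (\<xi> z * A (x + z) - A x) \<le> d" by simp
  moreover have "cmod (A (x + z) - A x) \<le> 2 * B / n"
    unfolding A_def by (rule avg_multiples_shift) (rule twist_bound[OF \<xi> B])
  moreover have "(\<xi> z - 1) * A x = (\<xi> z * A (x + z) - A x) - \<xi> z * (A (x + z) - A x)"
    by (simp add: algebra_simps)
  then have "cmod (\<xi> z - 1) * cmod (A x) = cmod ((\<xi> z * A (x + z) - A x) - \<xi> z * (A (x + z) - A x))"
    by (metis norm_mult)
  moreover have "cmod (\<xi> z * (A (x + z) - A x)) = cmod (A (x + z) - A x)"
    unfolding norm_mult character_norm[OF \<xi>] by simp
  ultimately have "cmod (\<xi> z - 1) * cmod (A x) \<le> d + 2 * B / n"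
    using norm_triangle_ineq4[of "\<xi> z * A (x + z) - A x" "\<xi> z * (A (x + z) - A x)"] by linarith
  moreover have "cmod (\<xi> z - 1) * c \<le> cmod (\<xi> z - 1) * cmod (A x)"
    by (intro mult_left_mono x) simp
  ultimately show "cmod (\<xi> z - 1) * c \<le> d + 2 * B / n" by simp
qed

text \<open>
  If \<open>\<xi> z\<close> were \<open>1\<close>, the twist of \<open>u x - u (x + z)\<close> would itself be such a difference, and its
  averages over multiples of \<open>z\<close> would telescope to \<open>0\<close>.
\<close>

lemma correlated_character_nontrivial:
  fixes u :: "'a::ab_group_add \<Rightarrow> real"
  assumes \<xi>: "character \<xi>"
    and corr: "\<And>L. L \<noteq> [] \<Longrightarrow> \<exists>x. c \<le> cmod (avg L (twist (\<lambda>x. u x - u (x + z)) \<xi>) x)"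
    and "c > 0" and B: "\<And>x. \<bar>u x\<bar> \<le> B"
  shows "\<xi> z \<noteq> 1"
proof
  assume "\<xi> z = 1"
  then have "twist (\<lambda>x. u x - u (x + z)) \<xi> x = twist u \<xi> x - twist u \<xi> (x + z)" for x
    by (simp add: twist_def character_add[OF \<xi>] algebra_simps)
  then have tw: "twist (\<lambda>x. u x - u (x + z)) \<xi> = (\<lambda>x. twist u \<xi> x - twist u \<xi> (x + z))" by blast
  have "c \<le> 0"
  proof (rule le_of_le_plus_inverse)
    fix n :: nat assume "n > 0"
    then obtain x where "c \<le> cmod (avg (multiples z n) (twist u \<xi>) x - avg (multiples z n) (twist u \<xi>) (x + z))"
      using corr[of "multiples z n"] unfolding tw avg_diff avg_translate by auto
    also have "\<dots> \<le> 2 * B / n"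
      unfolding norm_minus_commute[of "avg _ _ x"] by (rule avg_multiples_shift) (rule twist_bound[OF \<xi> B])
    finally show "c \<le> 0 + 2 * B / n" by simp
  qed
  with \<open>c > 0\<close> show False by simp
qed

definition cont_chars :: "('a::topological_ab_group_add \<Rightarrow> complex) set" where
  "cont_chars = {\<xi>. character \<xi> \<and> continuous_on UNIV \<xi>}"

lemma continuous_of_small_shifts:
  fixes f :: "'a::topological_ab_group_add \<Rightarrow> 'b::metric_space"
  assumes "\<And>e. e > 0 \<Longrightarrow> \<exists>V. open V \<and> 0 \<in> V \<and> (\<forall>x. \<forall>v\<in>V. dist (f (x + v)) (f x) < e)"
  shows "continuous_on UNIV f"
  unfolding continuous_on_def
proof
  fix x
  show "(f \<longlongrightarrow> f x) (at x)"
  proof (rule tendstoI)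
    fix e :: real assume "e > 0"
    then obtain V where V: "open V" "0 \<in> V" "\<forall>x. \<forall>v\<in>V. dist (f (x + v)) (f x) < e"
      using assms by blast
    have "open ((\<lambda>y. y - x) -` V)" by (intro open_vimage V continuous_intros)
    moreover have "dist (f y) (f x) < e" if "y \<in> (\<lambda>y. y - x) -` V" for y
      using V(3)[rule_format, of "y - x" x] that by simp
    ultimately show "\<forall>\<^sub>F y in at x. dist (f y) (f x) < e"
      unfolding eventually_at_topological using V(2) by (intro exI[of _ "(\<lambda>y. y - x) -` V"]) auto
  qed
qed

lemma continuous_subgroup_sup:
  fixes w :: "'a::topological_ab_group_add \<Rightarrow> real"
  assumes cpt: "compact (UNIV :: 'a set)" and w: "continuous_on UNIV w" and "N \<noteq> {}"
  shows "continuous_on UNIV (\<lambda>x. SUP n\<in>N. w (x + n))"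
proof (rule continuous_of_small_shifts)
  fix e :: real assume "e > 0"
  then have "e / 2 > 0" by simp
  then obtain V where V: "open V" "0 \<in> V" "\<And>x v. v \<in> V \<Longrightarrow> dist (w (x + v)) (w x) < e / 2"
    using uniformly_small_shift[OF cpt w] by blast
  obtain B where B: "\<And>x. norm (w x) \<le> B"
    using compact_imp_bounded[OF compact_continuous_image[OF w cpt]] unfolding bounded_iff by blast
  have bdd: "bdd_above ((\<lambda>n. w (x + n)) ` N)" for x
    using B by (intro bdd_aboveI2[of _ _ B]) (auto simp: abs_le_iff)
  have "dist (SUP n\<in>N. w (x + v + n)) (SUP n\<in>N. w (x + n)) < e" if "v \<in> V" for x v
  proof -
    have near: "\<bar>w (x + v + n) - w (x + n)\<bar> \<le> e / 2" for n
      using V(3)[OF that, of "x + n"] by (simp add: dist_real_def add_ac)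
    have "(SUP n\<in>N. w (x + v + n)) \<le> (SUP n\<in>N. w (x + n)) + e / 2"
    proof (rule cSUP_least[OF \<open>N \<noteq> {}\<close>])
      fix n assume "n \<in> N"
      then show "w (x + v + n) \<le> (SUP n\<in>N. w (x + n)) + e / 2"
        using cSUP_upper[OF _ bdd, of n x] near[of n] by linarith
    qed
    moreover have "(SUP n\<in>N. w (x + n)) \<le> (SUP n\<in>N. w (x + v + n)) + e / 2"
    proof (rule cSUP_least[OF \<open>N \<noteq> {}\<close>])
      fix n assume "n \<in> N"
      then show "w (x + n) \<le> (SUP n\<in>N. w (x + v + n)) + e / 2"
        using cSUP_upper[OF _ bdd, of n "x + v"] near[of n] by linarith
    qed
    ultimately show ?thesis using \<open>e > 0\<close> by (simp add: dist_real_def abs_if split: if_splits)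
  qed
  with V show "\<exists>V. open V \<and> 0 \<in> V \<and>
      (\<forall>x. \<forall>v\<in>V. dist (SUP n\<in>N. w (x + v + n)) (SUP n\<in>N. w (x + n)) < e)" by blast
qed

text \<open>
  A Urysohn function for the disjoint closed cosets \<open>N\<close> and \<open>z + N\<close> is made invariant by taking
  its supremum over the cosets of \<open>N\<close>.
\<close>

lemma invariant_separating_function:
  fixes N :: "'a::{topological_ab_group_add, t2_space} set"
  assumes cpt: "compact (UNIV :: 'a set)" and N: "add_subgroup N" "closed N" and "z \<notin> N"
  obtains u :: "'a \<Rightarrow> real" where "continuous_on UNIV u" "u 0 \<noteq> u z" "\<And>x n. n \<in> N \<Longrightarrow> u (x + n) = u x"
proof -
  have "Hausdorff_space (euclidean :: 'a topology)"
    unfolding Hausdorff_space_def disjnt_def by simp (metis hausdorff)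
  then have normal: "normal_space (euclidean :: 'a topology)"
    using compact_Hausdorff_or_regular_imp_normal_space[of "euclidean :: 'a topology"] cpt
    by (simp add: compact_space_def)
  have "closed ((\<lambda>y. y - z) -` N)"
    by (intro closed_vimage N continuous_intros)
  moreover have "N \<inter> (\<lambda>y. y - z) -` N = {}"
  proof -
    have False if "y \<in> N" "y - z \<in> N" for y
    proof -
      have "y + - (y - z) \<in> N" using that N(1) unfolding add_subgroup_def by blast
      then show False using \<open>z \<notin> N\<close> by simp
    qed
    then show ?thesis by auto
  qed
  ultimately obtain w where w: "continuous_map euclidean euclideanreal w"
      "w ` N \<subseteq> {1}" "w ` ((\<lambda>y. y - z) -` N) \<subseteq> {0}"
    using Urysohn_lemma_alt[OF normal, of N "(\<lambda>y. y - z) -` N" 1 0] N(2)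
    by (auto simp: disjnt_def)
  define u where "u x = (SUP n\<in>N. w (x + n))" for x
  have "0 \<in> N" using N(1) by (simp add: add_subgroup_def)
  have "u 0 = 1"
  proof -
    have "(\<lambda>n. w (0 + n)) ` N = {1}" using w(2) \<open>0 \<in> N\<close> by auto
    then show ?thesis by (simp add: u_def)
  qed
  moreover have "u z = 0"
  proof -
    have "w (z + n) = 0" if "n \<in> N" for n
    proof -
      have "z + n \<in> (\<lambda>y. y - z) -` N" using that by simp
      then show ?thesis using w(3) by blast
    qed
    then have "(\<lambda>n. w (z + n)) ` N = {0}" using \<open>0 \<in> N\<close> by auto
    then show ?thesis by (simp add: u_def)
  qed
  moreover have "u (x + n) = u x" if "n \<in> N" for x n
  proof -
    have shift: "(\<lambda>m. n + m) ` N = N"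
    proof
      show "(\<lambda>m. n + m) ` N \<subseteq> N" using N(1) that by (auto simp: add_subgroup_def)
      show "N \<subseteq> (\<lambda>m. n + m) ` N"
      proof
        fix m assume "m \<in> N"
        then have "- n + m \<in> N" using N(1) that unfolding add_subgroup_def by blast
        then show "m \<in> (\<lambda>m. n + m) ` N" by (intro image_eqI[of _ _ "- n + m"]) auto
      qed
    qed
    have "(\<lambda>m. w (x + n + m)) ` N = (\<lambda>m. w (x + m)) ` (\<lambda>m. n + m) ` N"
      by (simp add: image_image add.assoc)
    then have "(\<lambda>m. w (x + n + m)) ` N = (\<lambda>m. w (x + m)) ` N"
      unfolding shift .
    then show ?thesis by (simp add: u_def)
  qed
  moreover have "continuous_on UNIV u"
    unfolding u_def using w(1) \<open>0 \<in> N\<close> by (intro continuous_subgroup_sup cpt) auto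
  ultimately show thesis using that by simp
qed

text \<open>
  The theorem of Peter and Weyl for a compact abelian group modulo a closed subgroup. Take an
  \<open>N\<close>-invariant continuous \<open>u\<close> with \<open>u 0 \<noteq> u z\<close> and a character correlated with \<open>u x - u (x + z)\<close>:
  it is continuous and trivial on \<open>N\<close>, since it moves no faster than this function, and it is
  nontrivial at \<open>z\<close>.
\<close>

theorem separating_character:
  fixes N :: "'a::{topological_ab_group_add, t2_space} set"
  assumes cpt: "compact (UNIV :: 'a set)" and N: "add_subgroup N" "closed N" and "z \<notin> N"
  obtains \<xi> where "\<xi> \<in> cont_chars" "\<And>x. x \<in> N \<Longrightarrow> \<xi> x = 1" "\<xi> z \<noteq> 1"
proof -
  obtain u :: "'a \<Rightarrow> real" where u: "continuous_on UNIV u" "u 0 \<noteq> u z" "\<And>x n. n \<in> N \<Longrightarrow> u (x + n) = u x"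
    using invariant_separating_function[OF assms] by blast
  define f where "f = (\<lambda>x. u x - u (x + z))"
  have f: "continuous_on UNIV f"
    unfolding f_def by (intro continuous_intros continuous_on_compose2[OF u(1)]) auto
  have bounded: "\<exists>B. \<forall>x. \<bar>h x\<bar> \<le> B" if "continuous_on UNIV h" for h :: "'a \<Rightarrow> real"
    using compact_imp_bounded[OF compact_continuous_image[OF that cpt]] unfolding bounded_iff by auto
  obtain B where B: "\<And>x. \<bar>f x\<bar> \<le> B" using bounded[OF f] by blast
  obtain B' where B': "\<And>x. \<bar>u x\<bar> \<le> B'" using bounded[OF u(1)] by blast
  have "f 0 \<noteq> 0" using u(2) by (simp add: f_def)
  then obtain \<xi> c where \<xi>: "character \<xi>" and c: "c > 0"
    and corr: "\<And>L. L \<noteq> [] \<Longrightarrow> \<exists>x. c \<le> cmod (avg L (twist f \<xi>) x)"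
    using correlated_character[OF cpt f] by blast
  have near: "cmod (\<xi> v - 1) * c \<le> d" if "\<And>x. \<bar>f (x + v) - f x\<bar> \<le> d" for v d
    by (rule correlated_character_near_1[OF \<xi> corr B that])
  have "continuous_on UNIV \<xi>"
  proof (rule continuous_of_small_shifts)
    fix e :: real assume "e > 0"
    then have "e / 2 * c > 0" using c by simp
    then obtain V where V: "open V" "0 \<in> V" "\<And>x v. v \<in> V \<Longrightarrow> dist (f (x + v)) (f x) < e / 2 * c"
      using uniformly_small_shift[OF cpt f] by blast
    have "dist (\<xi> (x + v)) (\<xi> x) < e" if "v \<in> V" for x v
    proof -
      have "cmod (\<xi> v - 1) * c \<le> e / 2 * c"
        using V(3)[OF that] by (intro near) (auto simp: dist_real_def less_imp_le)
      then have "cmod (\<xi> v - 1) \<le> e / 2" using c by simp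
      moreover have "dist (\<xi> (x + v)) (\<xi> x) = cmod (\<xi> x * (\<xi> v - 1))"
        by (simp add: dist_norm character_add[OF \<xi>] algebra_simps)
      ultimately show ?thesis using \<open>e > 0\<close> by (simp add: norm_mult character_norm[OF \<xi>])
    qed
    with V show "\<exists>V. open V \<and> 0 \<in> V \<and> (\<forall>x. \<forall>v\<in>V. dist (\<xi> (x + v)) (\<xi> x) < e)" by blast
  qed
  moreover have "\<xi> n = 1" if "n \<in> N" for n
  proof -
    have "f (x + n) = f x" for x
      using u(3)[OF that, of x] u(3)[OF that, of "x + z"] by (simp add: f_def add_ac)
    then have "cmod (\<xi> n - 1) * c \<le> 0" by (intro near) simp
    then have "cmod (\<xi> n - 1) \<le> 0" using c by (simp add: mult_le_0_iff)
    then show ?thesis by simp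
  qed
  moreover have "\<xi> z \<noteq> 1"
    by (rule correlated_character_nontrivial[OF \<xi> corr[unfolded f_def] c B'])
  ultimately show thesis using that[of \<xi>] \<xi> by (auto simp: cont_chars_def)
qed

section \<open>Subgroups of the character group are determined by their common kernel\<close>

definition char_group :: "('a::topological_ab_group_add \<Rightarrow> complex) set \<Rightarrow> bool" where
  "char_group \<Phi> \<longleftrightarrow> \<Phi> \<subseteq> cont_chars \<and> (\<lambda>_. 1) \<in> \<Phi> \<and>
     (\<forall>\<phi>\<in>\<Phi>. \<forall>\<psi>\<in>\<Phi>. (\<lambda>x. \<phi> x * \<psi> x) \<in> \<Phi>) \<and> (\<forall>\<phi>\<in>\<Phi>. (\<lambda>x. cnj (\<phi> x)) \<in> \<Phi>)"

inductive_set trig_polys :: "('a \<Rightarrow> complex) set \<Rightarrow> ('a \<Rightarrow> complex) set" for \<Phi> where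
  monomial: "\<phi> \<in> \<Phi> \<Longrightarrow> (\<lambda>x. c * \<phi> x) \<in> trig_polys \<Phi>"
| add: "F \<in> trig_polys \<Phi> \<Longrightarrow> G \<in> trig_polys \<Phi> \<Longrightarrow> (\<lambda>x. F x + G x) \<in> trig_polys \<Phi>"

lemma trig_polys_mult:
  assumes \<Phi>: "char_group \<Phi>" and "F \<in> trig_polys \<Phi>" "G \<in> trig_polys \<Phi>"
  shows "(\<lambda>x. F x * G x) \<in> trig_polys \<Phi>"
  using assms(2)
proof induction
  case (monomial \<phi> c)
  from assms(3) show ?case
  proof induction
    case (monomial \<psi> d)
    then have "(\<lambda>x. (c * d) * (\<phi> x * \<psi> x)) \<in> trig_polys \<Phi>"
      using \<Phi> \<open>\<phi> \<in> \<Phi>\<close> by (intro trig_polys.monomial) (auto simp: char_group_def)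
    then show ?case by (simp add: mult_ac)
  next
    case (add F G)
    from trig_polys.add[OF add.IH] show ?case by (simp add: algebra_simps)
  qed
next
  case (add F' G')
  from trig_polys.add[OF add.IH] show ?case by (simp add: algebra_simps)
qed

lemma trig_polys_const:
  assumes "char_group \<Phi>"
  shows "(\<lambda>x. c) \<in> trig_polys \<Phi>"
  using trig_polys.monomial[of "\<lambda>_. 1" \<Phi> c] assms by (simp add: char_group_def)

lemma trig_polys_polynomial:
  assumes \<Phi>: "char_group \<Phi>" and h: "(\<lambda>x. complex_of_real (h x)) \<in> trig_polys \<Phi>"
    and p: "real_polynomial_function p"
  shows "(\<lambda>x. complex_of_real (p (h x))) \<in> trig_polys \<Phi>"
  using p
proof induction
  case (linear f)
  then have "f s = f 1 * s" for s
    using linear_scale[OF bounded_linear.linear[OF linear], of s 1] by simp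
  then have "complex_of_real (f (h x)) = of_real (f 1) * of_real (h x)" for x by (metis of_real_mult)
  then show ?case
    using trig_polys_mult[OF \<Phi> trig_polys_const[OF \<Phi>, of "of_real (f 1)"] h] by simp
next
  case (const c)
  show ?case using trig_polys_const[OF \<Phi>] .
next
  case (add f g)
  from trig_polys.add[OF add.IH] show ?case by simp
next
  case (mult f g)
  from trig_polys_mult[OF \<Phi> mult.IH] show ?case by simp
qed

lemma has_mean_nontrivial_character:
  assumes \<xi>: "character \<xi>" and "\<xi> z \<noteq> 1"
  shows "has_mean \<xi> 0"
  unfolding has_mean_def
proof (intro allI impI)
  fix e :: real assume "e > 0"
  define d where "d = cmod (\<xi> z - 1)"
  have "d > 0" using assms by (simp add: d_def)
  obtain n :: nat where n: "2 / (e * d) < real n" using reals_Archimedean2 by blast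
  moreover have "2 / (e * d) > 0" using \<open>e > 0\<close> \<open>d > 0\<close> by simp
  ultimately have "n > 0" by (metis gr0I not_less_iff_gr_or_eq of_nat_0)
  define A where "A = avg (multiples z n) \<xi>"
  have "cmod (A x) \<le> e" for x
  proof -
    have "A (x + z) = \<xi> z * A x"
      unfolding A_def avg_translate[symmetric]
      using avg_linear[OF bounded_linear.linear[OF bounded_linear_mult_right], of "multiples z n" "\<xi> z" \<xi> x]
      by (simp add: character_add[OF \<xi>] mult.commute)
    then have "A (x + z) - A x = (\<xi> z - 1) * A x" by (simp add: algebra_simps)
    moreover have "cmod (A (x + z) - A x) \<le> 2 * 1 / n"
      unfolding A_def by (rule avg_multiples_shift) (simp add: character_norm[OF \<xi>])
    ultimately have "d * cmod (A x) \<le> 2 / n" by (simp add: d_def norm_mult)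
    also have "2 / n \<le> e * d"
      using n \<open>e > 0\<close> \<open>d > 0\<close> \<open>n > 0\<close> by (simp add: field_simps less_imp_le)
    finally show ?thesis using \<open>d > 0\<close> by (simp add: mult.commute)
  qed
  then show "\<exists>L. L \<noteq> [] \<and> (\<forall>x. cmod (avg L \<xi> x - 0) \<le> e)"
    using \<open>n > 0\<close> unfolding A_def by (intro exI[of _ "multiples z n"]) auto
qed

text \<open>
  Orthogonality of characters: products of members of \<open>\<Phi>\<close> with \<open>\<psi>\<close> are nontrivial characters and
  have mean \<open>0\<close>.
\<close>

lemma trig_polys_orthogonal:
  assumes \<Phi>: "char_group \<Phi>" and \<psi>: "character \<psi>" "\<psi> \<notin> \<Phi>" and F: "F \<in> trig_polys \<Phi>"
  shows "has_mean (\<lambda>x. F x * \<psi> x) 0"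
  using F
proof induction
  case (monomial \<phi> c)
  have \<phi>: "character \<phi>" using monomial \<Phi> by (auto simp: char_group_def cont_chars_def)
  have "\<exists>z. \<phi> z * \<psi> z \<noteq> 1"
  proof (rule ccontr)
    assume "\<not> ?thesis"
    then have "\<psi> z = cnj (\<phi> z)" for z
      using character_cnj[OF \<phi>, of z] by (metis mult.commute mult.right_neutral mult.left_commute)
    then have "\<psi> = (\<lambda>z. cnj (\<phi> z))" by blast
    then show False using monomial \<Phi> \<psi>(2) by (auto simp: char_group_def)
  qed
  moreover have "character (\<lambda>x. \<phi> x * \<psi> x)"
    using \<phi> \<psi> by (simp add: character_def norm_mult mult_ac)
  ultimately have "has_mean (\<lambda>x. \<phi> x * \<psi> x) 0"
    using has_mean_nontrivial_character by blast
  from has_mean_linear[OF bounded_linear_mult_right this, of c] show ?case by (simp add: mult_ac)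
next
  case (add F G)
  from has_mean_add[OF add.IH] show ?case by (simp add: algebra_simps)
qed

text \<open>
  Suppose \<open>\<psi>\<close> is trivial on the common kernel of \<open>\<Phi>\<close> but not in \<open>\<Phi>\<close>. By compactness finitely many
  members of \<open>\<Phi>\<close> suffice to keep \<open>\<psi>\<close> near \<open>1\<close>: there is a trigonometric polynomial \<open>h \<ge> 0\<close> with
  characters from \<open>\<Phi>\<close> such that \<open>Re (\<psi> x) > 1/2\<close> wherever \<open>h x < d\<close>. A bump \<open>q\<close> supported on
  \<open>h x < d\<close> then gives a nonnegative function \<open>F = q \<circ> h\<close> for which the mean of \<open>F * Re \<psi>\<close> is at
  least half that of \<open>F\<close>, hence positive. But \<open>F\<close> is a uniform limit of polynomials in \<open>h\<close>, and
  these are orthogonal to \<open>\<psi>\<close>.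
\<close>

theorem char_group_annihilator:
  fixes \<Phi> :: "('a::{topological_ab_group_add, t2_space} \<Rightarrow> complex) set"
  assumes cpt: "compact (UNIV :: 'a set)" and \<Phi>: "char_group \<Phi>" and \<psi>: "\<psi> \<in> cont_chars"
    and kernel: "\<And>x. (\<And>\<phi>. \<phi> \<in> \<Phi> \<Longrightarrow> \<phi> x = 1) \<Longrightarrow> \<psi> x = 1"
  shows "\<psi> \<in> \<Phi>"
proof (rule ccontr)
  assume "\<psi> \<notin> \<Phi>"
  have \<psi>': "character \<psi>" "continuous_on UNIV \<psi>" using \<psi> by (auto simp: cont_chars_def)
  have char: "character \<phi>" "continuous_on UNIV \<phi>" if "\<phi> \<in> \<Phi>" for \<phi>
    using that \<Phi> by (auto simp: char_group_def cont_chars_def)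
  define C where "C = {x. Re (\<psi> x) \<le> 1 / 2}"
  have "closed C" unfolding C_def by (intro closed_Collect_le continuous_intros \<psi>')
  then have "compact C" using compact_Int_closed[OF cpt] by simp
  have "\<exists>\<Phi>0. finite \<Phi>0 \<and> \<Phi>0 \<subseteq> \<Phi> \<and> C \<inter> (\<Inter>\<phi>\<in>\<Phi>0. {x. \<phi> x = 1}) = {}"
  proof (rule ccontr)
    assume *: "\<not> ?thesis"
    have "C \<inter> (\<Inter>\<phi>\<in>\<Phi>. {x. \<phi> x = 1}) \<noteq> {}"
    proof (rule compact_imp_fip_image[OF \<open>compact C\<close>])
      show "closed {x. \<phi> x = 1}" if "\<phi> \<in> \<Phi>" for \<phi>
        by (intro closed_Collect_eq continuous_intros char that)
      show "C \<inter> (\<Inter>\<phi>\<in>\<Phi>'. {x. \<phi> x = 1}) \<noteq> {}" if "finite \<Phi>'" "\<Phi>' \<subseteq> \<Phi>" for \<Phi>'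
        using * that by blast
    qed
    then obtain x where x: "x \<in> C" "\<forall>\<phi>\<in>\<Phi>. \<phi> x = 1" by blast
    then have "\<psi> x = 1" by (intro kernel) simp
    with x(1) show False by (simp add: C_def)
  qed
  then obtain \<Phi>0 where \<Phi>0: "finite \<Phi>0" "\<Phi>0 \<subseteq> \<Phi>" "C \<inter> (\<Inter>\<phi>\<in>\<Phi>0. {x. \<phi> x = 1}) = {}" by blast
  define h where "h x = (\<Sum>\<phi>\<in>\<Phi>0. 1 - Re (\<phi> x))" for x
  have re_le: "Re (\<phi> x) \<le> 1" if "\<phi> \<in> \<Phi>0" for \<phi> x
    using complex_Re_le_cmod[of "\<phi> x"] character_norm[OF char(1), of \<phi> x] that \<Phi>0 by auto
  have h: "continuous_on UNIV h"
    unfolding h_def using \<Phi>0 by (intro continuous_intros char) auto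
  have h_nonneg: "h x \<ge> 0" for x unfolding h_def using re_le by (intro sum_nonneg) auto
  have h_pos: "h x > 0" if "x \<in> C" for x
  proof -
    obtain \<phi> where \<phi>: "\<phi> \<in> \<Phi>0" "\<phi> x \<noteq> 1" using \<Phi>0(3) \<open>x \<in> C\<close> by blast
    have "Re (\<phi> x) \<noteq> 1"
    proof
      assume "Re (\<phi> x) = 1"
      moreover have "cmod (\<phi> x) = 1" using character_norm[OF char(1)] \<phi>(1) \<Phi>0(2) by blast
      ultimately have "Im (\<phi> x) = 0" by (simp add: cmod_def)
      then show False using \<phi>(2) \<open>Re (\<phi> x) = 1\<close> by (simp add: complex_eq_iff)
    qed
    then have "0 < 1 - Re (\<phi> x)" using re_le[OF \<phi>(1), of x] by simp
    also have "\<dots> \<le> h x"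
      unfolding h_def using re_le by (intro member_le_sum \<phi> \<Phi>0) auto
    finally show ?thesis .
  qed
  obtain d where d: "d > 0" "\<And>x. x \<in> C \<Longrightarrow> d \<le> h x"
  proof (cases "C = {}")
    case False
    then obtain y where "y \<in> C" "\<And>x. x \<in> C \<Longrightarrow> h y \<le> h x"
      using continuous_attains_inf[OF \<open>compact C\<close>] continuous_on_subset[OF h] by blast
    then show ?thesis using that[of "h y"] h_pos by blast
  qed (use that[of 1] in auto)
  define q where "q s = max 0 (1 - s / d)" for s
  define F where "F x = q (h x)" for x
  have F: "continuous_on UNIV F" unfolding F_def q_def using d(1) by (intro continuous_intros h) auto
  obtain m where m: "has_mean F m" using has_mean_exists[OF cpt F] by blast
  have "h 0 = 0" unfolding h_def
    using \<Phi>0(2) by (intro sum.neutral) (auto simp: character_0[OF char(1)])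
  then have "F 0 > 0" by (simp add: F_def q_def)
  then have "m > 0"
    using has_mean_pos[OF cpt F _ _ m, of 0] by (simp add: F_def q_def)
  have range: "compact (range h)" using compact_continuous_image[OF h cpt] .
  have q: "continuous_on (range h) q" unfolding q_def using d(1) by (intro continuous_intros) auto
  have "m / 4 > 0" using \<open>m > 0\<close> by simp
  then obtain p where p: "real_polynomial_function p" "\<And>s. s \<in> range h \<Longrightarrow> \<bar>q s - p s\<bar> < m / 4"
    using Stone_Weierstrass_real_polynomial_function[OF range q] by blast
  have "(\<lambda>x. complex_of_real (h x)) \<in> trig_polys \<Phi>"
    unfolding h_def using \<Phi>0(1,2)
  proof (induction rule: finite_induct)
    case empty
    show ?case using trig_polys_const[OF \<Phi>, of 0] by simp
  next
    case (insert \<phi> \<Phi>')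
    then have "\<phi> \<in> \<Phi>" "(\<lambda>x. cnj (\<phi> x)) \<in> \<Phi>" using \<Phi> by (auto simp: char_group_def)
    then have "(\<lambda>x. 1 + ((- 1 / 2) * \<phi> x + (- 1 / 2) * cnj (\<phi> x))) \<in> trig_polys \<Phi>"
      by (intro trig_polys.add trig_polys_const[OF \<Phi>] trig_polys.monomial[of "\<lambda>x. cnj (\<phi> x)"] trig_polys.monomial)
    moreover have "1 + ((- 1 / 2) * \<phi> x + (- 1 / 2) * cnj (\<phi> x)) = of_real (1 - Re (\<phi> x))" for x
      by (simp add: complex_eq_iff)
    ultimately have "(\<lambda>x. complex_of_real (1 - Re (\<phi> x))) \<in> trig_polys \<Phi>" by simp
    with insert show ?case
      using trig_polys.add[of "\<lambda>x. complex_of_real (1 - Re (\<phi> x))" \<Phi> "\<lambda>x. complex_of_real (\<Sum>\<phi>\<in>\<Phi>'. 1 - Re (\<phi> x))"]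
      by simp
  qed
  from trig_polys_orthogonal[OF \<Phi> \<psi>'(1) \<open>\<psi> \<notin> \<Phi>\<close> trig_polys_polynomial[OF \<Phi> this p(1)]]
  have "has_mean (\<lambda>x. Re (of_real (p (h x)) * \<psi> x)) (Re 0)"
    by (rule has_mean_linear[OF bounded_linear_Re])
  then have mean_p: "has_mean (\<lambda>x. p (h x) * Re (\<psi> x) + m / 4) (m / 4)"
    using has_mean_add[OF _ has_mean_const[of "m / 4"], of "\<lambda>x. p (h x) * Re (\<psi> x)" 0] by simp
  have "has_mean (\<lambda>x. F x * (1 / 2)) (m * (1 / 2))"
    by (rule has_mean_linear[OF bounded_linear_mult_left m])
  from this mean_p have "m * (1 / 2) \<le> m / 4"
  proof (rule has_mean_mono)
    fix x
    have "F x * (1 / 2) \<le> F x * Re (\<psi> x)"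
    proof (cases "x \<in> C")
      case True
      then have "F x = 0" using d by (simp add: F_def q_def)
      then show ?thesis by simp
    next
      case False
      then show ?thesis unfolding C_def by (intro mult_left_mono) (auto simp: F_def q_def)
    qed
    also have "F x * Re (\<psi> x) - p (h x) * Re (\<psi> x) \<le> m / 4"
    proof -
      have "\<bar>Re (\<psi> x)\<bar> \<le> 1"
        using abs_Re_le_cmod[of "\<psi> x"] character_norm[OF \<psi>'(1), of x] by simp
      then have "\<bar>(F x - p (h x)) * Re (\<psi> x)\<bar> \<le> m / 4 * 1"
        unfolding abs_mult using p(2)[of "h x"] \<open>m > 0\<close> by (intro mult_mono) (auto simp: F_def)
      then show ?thesis by (simp only: left_diff_distrib abs_le_iff mult_1_right)
    qed
    then have "F x * Re (\<psi> x) \<le> p (h x) * Re (\<psi> x) + m / 4" by simp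
    finally show "F x * (1 / 2) \<le> p (h x) * Re (\<psi> x) + m / 4" .
  qed
  with \<open>m > 0\<close> show False by simp
qed

section \<open>Independent characters\<close>

lemma character_nonzero: "character \<xi> \<Longrightarrow> \<xi> x \<noteq> 0"
  using character_norm[of \<xi> x] by auto

lemma inverse_character:
  assumes "character \<xi>"
  shows "inverse (\<xi> x) = cnj (\<xi> x)"
  using character_cnj[OF assms, of x] by (metis inverse_unique)

lemma char_group_mult: "char_group \<Phi> \<Longrightarrow> \<phi> \<in> \<Phi> \<Longrightarrow> \<psi> \<in> \<Phi> \<Longrightarrow> (\<lambda>x. \<phi> x * \<psi> x) \<in> \<Phi>"
  by (simp add: char_group_def)

lemma char_group_cnj: "char_group \<Phi> \<Longrightarrow> \<phi> \<in> \<Phi> \<Longrightarrow> (\<lambda>x. cnj (\<phi> x)) \<in> \<Phi>"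
  by (simp add: char_group_def)

lemma char_group_one: "char_group \<Phi> \<Longrightarrow> (\<lambda>_. 1) \<in> \<Phi>"
  by (simp add: char_group_def)

lemma char_group_character: "char_group \<Phi> \<Longrightarrow> \<phi> \<in> \<Phi> \<Longrightarrow> character \<phi>"
  by (auto simp: char_group_def cont_chars_def)

lemma char_group_cont_chars: "char_group cont_chars"
  by (auto simp: char_group_def cont_chars_def character_def norm_mult mult_ac intro!: continuous_intros)

lemma char_group_power:
  assumes "char_group \<Phi>" "\<phi> \<in> \<Phi>"
  shows "(\<lambda>x. \<phi> x ^ n) \<in> \<Phi>"
proof (induction n)
  case (Suc n)
  then show ?case using char_group_mult[OF assms Suc] by simp
qed (use assms char_group_one in auto)

lemma char_group_powi:
  assumes "char_group \<Phi>" "\<phi> \<in> \<Phi>"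
  shows "(\<lambda>x. \<phi> x powi k) \<in> \<Phi>"
  using char_group_power[OF assms, of "nat k"]
    char_group_power[OF assms(1) char_group_cnj[OF assms], of "nat (- k)"]
  by (cases "k \<ge> 0") (auto simp: power_int_def inverse_character[OF char_group_character[OF assms]])

inductive_set char_span :: "('a \<Rightarrow> complex) set \<Rightarrow> ('a \<Rightarrow> complex) set" for S where
  one: "(\<lambda>_. 1) \<in> char_span S"
| mult: "\<phi> \<in> S \<Longrightarrow> \<psi> \<in> char_span S \<Longrightarrow> (\<lambda>x. \<phi> x * \<psi> x) \<in> char_span S"
| inv: "\<phi> \<in> S \<Longrightarrow> \<psi> \<in> char_span S \<Longrightarrow> (\<lambda>x. cnj (\<phi> x) * \<psi> x) \<in> char_span S"

lemma char_span_superset: "\<phi> \<in> S \<Longrightarrow> \<phi> \<in> char_span S"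
  using char_span.mult[OF _ char_span.one, of \<phi> S] by simp

lemma char_span_mono:
  assumes "S \<subseteq> T"
  shows "char_span S \<subseteq> char_span T"
proof
  fix \<psi> assume "\<psi> \<in> char_span S"
  then show "\<psi> \<in> char_span T"
    by induction (use assms in \<open>auto intro: char_span.intros\<close>)
qed

lemma char_group_char_span:
  assumes "S \<subseteq> cont_chars"
  shows "char_group (char_span S)"
  unfolding char_group_def
proof (intro conjI ballI)
  show "char_span S \<subseteq> cont_chars"
  proof
    fix \<psi> assume "\<psi> \<in> char_span S"
    then show "\<psi> \<in> cont_chars"
    proof induction
      case one
      show ?case by (rule char_group_one[OF char_group_cont_chars])
    next
      case (mult \<phi> \<psi>)
      then show ?case using assms by (intro char_group_mult[OF char_group_cont_chars]) auto
    next
      case (inv \<phi> \<psi>)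
      then show ?case
        using assms by (intro char_group_mult[OF char_group_cont_chars]
            char_group_cnj[OF char_group_cont_chars]) auto
    qed
  qed
  show "(\<lambda>_. 1) \<in> char_span S" by (rule char_span.one)
  show "(\<lambda>x. \<phi> x * \<psi> x) \<in> char_span S" if "\<phi> \<in> char_span S" "\<psi> \<in> char_span S" for \<phi> \<psi>
    using that(1)
  proof induction
    case one
    show ?case using that(2) by simp
  next
    case (mult \<phi>' \<psi>')
    from char_span.mult[OF mult.hyps(1) mult.IH] show ?case by (simp add: mult.assoc)
  next
    case (inv \<phi>' \<psi>')
    from char_span.inv[OF inv.hyps(1) inv.IH] show ?case by (simp add: mult.assoc)
  qed
  show "(\<lambda>x. cnj (\<phi> x)) \<in> char_span S" if "\<phi> \<in> char_span S" for \<phi>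
    using that
  proof induction
    case one
    show ?case by (simp add: char_span.one)
  next
    case (mult \<phi>' \<psi>')
    from char_span.inv[OF mult.hyps(1) mult.IH] show ?case by simp
  next
    case (inv \<phi>' \<psi>')
    from char_span.mult[OF inv.hyps(1) inv.IH] show ?case by simp
  qed
qed

lemma char_span_finite:
  assumes "\<psi> \<in> char_span S"
  obtains F where "finite F" "F \<subseteq> S" "\<psi> \<in> char_span F"
proof -
  have "\<exists>F. finite F \<and> F \<subseteq> S \<and> \<psi> \<in> char_span F"
    using assms
  proof induction
    case one
    show ?case by (auto intro: char_span.one)
  next
    case (mult \<phi> \<psi>)
    then obtain F where F: "finite F" "F \<subseteq> S" "\<psi> \<in> char_span F" by blast
    then have "\<psi> \<in> char_span (insert \<phi> F)" using char_span_mono[of F "insert \<phi> F"] by blast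
    with F mult.hyps show ?case by (intro exI[of _ "insert \<phi> F"]) (auto intro: char_span.mult)
  next
    case (inv \<phi> \<psi>)
    then obtain F where F: "finite F" "F \<subseteq> S" "\<psi> \<in> char_span F" by blast
    then have "\<psi> \<in> char_span (insert \<phi> F)" using char_span_mono[of F "insert \<phi> F"] by blast
    with F inv.hyps show ?case by (intro exI[of _ "insert \<phi> F"]) (auto intro: char_span.inv)
  qed
  then show thesis using that by blast
qed

lemma char_span_insert:
  assumes \<xi>: "character \<xi>" and "\<psi> \<in> char_span (insert \<xi> S)"
  obtains k \<beta> where "\<beta> \<in> char_span S" "\<psi> = (\<lambda>x. \<xi> x powi k * \<beta> x)"
proof -
  have "\<exists>k. \<exists>\<beta>\<in>char_span S. \<psi> = (\<lambda>x. \<xi> x powi k * \<beta> x)"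
    using assms(2)
  proof induction
    case one
    show ?case by (intro exI[of _ 0] bexI[OF _ char_span.one]) simp
  next
    case (mult \<phi> \<psi>)
    then obtain k \<beta> where \<beta>: "\<beta> \<in> char_span S" "\<psi> = (\<lambda>x. \<xi> x powi k * \<beta> x)" by blast
    show ?case
    proof (cases "\<phi> = \<xi>")
      case True
      then show ?thesis unfolding \<beta>(2)
        by (intro exI[of _ "k + 1"] bexI[OF _ \<beta>(1)]) (simp add: power_int_add character_nonzero[OF \<xi>] mult_ac)
    next
      case False
      then have "(\<lambda>x. \<phi> x * \<beta> x) \<in> char_span S" using mult.hyps \<beta> by (auto intro: char_span.mult)
      then show ?thesis unfolding \<beta>(2) by (intro exI[of _ k] bexI) (simp_all add: mult_ac)
    qed
  next
    case (inv \<phi> \<psi>)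
    then obtain k \<beta> where \<beta>: "\<beta> \<in> char_span S" "\<psi> = (\<lambda>x. \<xi> x powi k * \<beta> x)" by blast
    show ?case
    proof (cases "\<phi> = \<xi>")
      case True
      then show ?thesis unfolding \<beta>(2)
        by (intro exI[of _ "k - 1"] bexI[OF _ \<beta>(1)])
           (simp add: power_int_diff character_nonzero[OF \<xi>] divide_inverse inverse_character[OF \<xi>] mult_ac)
    next
      case False
      then have "(\<lambda>x. cnj (\<phi> x) * \<beta> x) \<in> char_span S" using inv.hyps \<beta> by (auto intro: char_span.inv)
      then show ?thesis unfolding \<beta>(2) by (intro exI[of _ k] bexI) (simp_all add: mult_ac)
    qed
  qed
  then show thesis using that by blast
qed

text \<open>
  Independence in the sense of abelian groups, which allows torsion: the cyclic groups generated
  by the members of \<open>I\<close> form a direct sum. A relation need not have zero exponents, but each of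
  its factors must be trivial.
\<close>

definition indep_chars :: "('a::topological_ab_group_add \<Rightarrow> complex) set \<Rightarrow> bool" where
  "indep_chars I \<longleftrightarrow> I \<subseteq> cont_chars \<and> (\<lambda>_. 1) \<notin> I \<and>
     (\<forall>\<xi>\<in>I. \<forall>k. (\<lambda>x. \<xi> x powi k) \<in> char_span (I - {\<xi>}) \<longrightarrow> (\<lambda>x. \<xi> x powi k) = (\<lambda>_. 1))"

text \<open>
  In a direct sum an element has finitely many nonzero coordinates; if it can also be written
  without these coordinates, it is trivial.
\<close>

lemma indep_chars_cofinite:
  assumes I: "indep_chars I" and cof: "\<And>F. finite F \<Longrightarrow> F \<subseteq> I \<Longrightarrow> \<psi> \<in> char_span (I - F)"
  shows "\<psi> = (\<lambda>_. 1)"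
proof -
  have sub: "I \<subseteq> cont_chars" using I by (simp add: indep_chars_def)
  have *: "\<psi> = (\<lambda>_. 1)" if "finite F" "F \<subseteq> I" "\<psi> \<in> char_span F" "\<psi> \<in> char_span (I - F)" for F \<psi>
    using that
  proof (induction F arbitrary: \<psi> rule: finite_induct)
    case empty
    from empty(2) show ?case by (cases rule: char_span.cases) auto
  next
    case (insert \<xi> F)
    have \<xi>: "character \<xi>" using insert.prems sub by (auto simp: cont_chars_def)
    obtain k \<beta> where \<beta>: "\<beta> \<in> char_span F" "\<psi> = (\<lambda>x. \<xi> x powi k * \<beta> x)"
      using char_span_insert[OF \<xi> insert.prems(2)] by blast
    have G: "char_group (char_span (I - {\<xi>}))"
      using sub by (intro char_group_char_span) auto
    have b: "\<beta> \<in> char_span (I - {\<xi>})"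
      using \<beta>(1) insert.hyps insert.prems(1) char_span_mono[of F "I - {\<xi>}"] by blast
    have p: "\<psi> \<in> char_span (I - {\<xi>})"
      using insert.prems(3) char_span_mono[of "I - insert \<xi> F" "I - {\<xi>}"] by blast
    have "\<psi> x * cnj (\<beta> x) = \<xi> x powi k" for x
      using character_cnj[OF char_group_character[OF G b], of x] by (simp add: \<beta>(2) mult.assoc)
    then have "(\<lambda>x. \<xi> x powi k) \<in> char_span (I - {\<xi>})"
      using char_group_mult[OF G p char_group_cnj[OF G b]] by simp
    then have "(\<lambda>x. \<xi> x powi k) = (\<lambda>_. 1)"
      using I insert.prems(1) by (auto simp: indep_chars_def)
    then have "\<xi> x powi k = 1" for x by meson
    then have "\<psi> = \<beta>" using \<beta>(2) by simp
    moreover have "\<psi> \<in> char_span (I - F)"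
      using insert.prems(3) char_span_mono[of "I - insert \<xi> F" "I - F"] by blast
    ultimately show ?case using insert.IH[of \<psi>] insert.prems(1) \<beta>(1) by blast
  qed
  have "\<psi> \<in> char_span I" using cof[of "{}"] by simp
  then obtain F where "finite F" "F \<subseteq> I" "\<psi> \<in> char_span F" using char_span_finite by blast
  then show ?thesis using * cof by blast
qed

lemma exists_maximal_indep_chars:
  obtains I :: "('a::topological_ab_group_add \<Rightarrow> complex) set"
  where "indep_chars I" "\<And>J. indep_chars J \<Longrightarrow> I \<subseteq> J \<Longrightarrow> J = I"
proof -
  define A where "A = Collect (indep_chars :: ('a \<Rightarrow> complex) set \<Rightarrow> bool)"
  have "\<exists>M\<in>A. \<forall>X\<in>A. M \<subseteq> X \<longrightarrow> X = M"
  proof (rule subset_Zorn_nonempty)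
    show "A \<noteq> {}" by (auto simp: A_def indep_chars_def intro!: exI[of _ "{}"])
    fix C assume C: "C \<noteq> {}" "subset.chain A C"
    have mem: "indep_chars X" if "X \<in> C" for X using C that by (auto simp: A_def subset.chain_def)
    have "(\<lambda>x. \<xi> x powi k) = (\<lambda>_. 1)"
      if "\<xi> \<in> \<Union>C" and span: "(\<lambda>x. \<xi> x powi k) \<in> char_span (\<Union>C - {\<xi>})" for \<xi> k
    proof -
      obtain F where F: "finite F" "F \<subseteq> \<Union>C - {\<xi>}" "(\<lambda>x. \<xi> x powi k) \<in> char_span F"
        using char_span_finite[OF span] by blast
      have "finite (insert \<xi> F)" "insert \<xi> F \<subseteq> \<Union>C" using F that by auto
      then obtain X where X: "X \<in> C" "insert \<xi> F \<subseteq> X"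
        using finite_subset_Union_chain[OF _ _ C] by metis
      have "(\<lambda>x. \<xi> x powi k) \<in> char_span (X - {\<xi>})"
        using F X char_span_mono[of F "X - {\<xi>}"] by blast
      then show ?thesis using mem[OF X(1)] X(2) by (simp add: indep_chars_def)
    qed
    then show "\<Union>C \<in> A" using mem unfolding A_def indep_chars_def by blast
  qed
  then show thesis using that unfolding A_def by blast
qed

text \<open>
  A maximal independent set spans an essential subgroup: a cyclic group that meets the span
  trivially could be added to the direct sum.
\<close>

lemma maximal_indep_chars_power:
  assumes I: "indep_chars I" and max: "\<And>J. indep_chars J \<Longrightarrow> I \<subseteq> J \<Longrightarrow> J = I"
    and \<alpha>: "\<alpha> \<in> cont_chars" "\<alpha> \<noteq> (\<lambda>_. 1)"
  shows "\<exists>k. (\<lambda>x. \<alpha> x powi k) \<in> char_span I \<and> (\<lambda>x. \<alpha> x powi k) \<noteq> (\<lambda>_. 1)"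
proof (rule ccontr)
  assume "\<not> ?thesis"
  then have triv: "(\<lambda>x. \<alpha> x powi k) = (\<lambda>_. 1)" if "(\<lambda>x. \<alpha> x powi k) \<in> char_span I" for k
    using that by blast
  have sub: "I \<subseteq> cont_chars" using I by (simp add: indep_chars_def)
  have "\<alpha> \<notin> I" using triv[of 1] \<alpha>(2) char_span_superset by fastforce
  have "(\<lambda>x. \<xi> x powi k) = (\<lambda>_. 1)"
    if \<xi>: "\<xi> \<in> insert \<alpha> I" and span: "(\<lambda>x. \<xi> x powi k) \<in> char_span (insert \<alpha> I - {\<xi>})" for \<xi> k
  proof (cases "\<xi> = \<alpha>")
    case True
    then show ?thesis using span \<open>\<alpha> \<notin> I\<close> triv by simp
  next
    case False
    then have "\<xi> \<in> I" "insert \<alpha> I - {\<xi>} = insert \<alpha> (I - {\<xi>})" using \<xi> by auto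
    then have span': "(\<lambda>x. \<xi> x powi k) \<in> char_span (insert \<alpha> (I - {\<xi>}))" using span by simp
    have "character \<alpha>" using \<alpha>(1) by (simp add: cont_chars_def)
    then obtain m \<beta> where \<beta>: "\<beta> \<in> char_span (I - {\<xi>})" "(\<lambda>x. \<xi> x powi k) = (\<lambda>x. \<alpha> x powi m * \<beta> x)"
      using char_span_insert[OF _ span'] by blast
    have G: "char_group (char_span I)" by (rule char_group_char_span[OF sub])
    have b: "\<beta> \<in> char_span I" using \<beta>(1) char_span_mono[of "I - {\<xi>}" I] by blast
    have "\<xi> x powi k * cnj (\<beta> x) = \<alpha> x powi m" for x
      using character_cnj[OF char_group_character[OF G b], of x] fun_cong[OF \<beta>(2), of x] by (simp add: mult.assoc)
    then have "(\<lambda>x. \<alpha> x powi m) \<in> char_span I"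
      using char_group_mult[OF G char_group_powi[OF G char_span_superset[OF \<open>\<xi> \<in> I\<close>]] char_group_cnj[OF G b], of k]
      by simp
    then have "(\<lambda>x. \<alpha> x powi m) = (\<lambda>_. 1)" by (rule triv)
    then have "\<alpha> x powi m = 1" for x by meson
    then have "(\<lambda>x. \<xi> x powi k) = \<beta>" using \<beta>(2) by simp
    then have "(\<lambda>x. \<xi> x powi k) \<in> char_span (I - {\<xi>})" using \<beta>(1) by simp
    then show ?thesis using I \<open>\<xi> \<in> I\<close> unfolding indep_chars_def by blast
  qed
  then have "indep_chars (insert \<alpha> I)"
    using I \<alpha> by (auto simp: indep_chars_def)
  with max[of "insert \<alpha> I"] \<open>\<alpha> \<notin> I\<close> show False by blast
qed

text \<open>
  A cyclic group of prime order that meets the span nontrivially lies in it.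
\<close>

lemma maximal_indep_chars_torsion:
  assumes I: "indep_chars I" and max: "\<And>J. indep_chars J \<Longrightarrow> I \<subseteq> J \<Longrightarrow> J = I"
    and \<alpha>: "\<alpha> \<in> cont_chars" and p: "prime p" "\<And>x. \<alpha> x ^ p = 1"
  shows "\<alpha> \<in> char_span I"
proof (cases "\<alpha> = (\<lambda>_. 1)")
  case True
  then show ?thesis by (simp add: char_span.one)
next
  case False
  have G: "char_group (char_span I)" using I by (intro char_group_char_span) (simp add: indep_chars_def)
  have nz: "\<alpha> x \<noteq> 0" for x using \<alpha> character_nonzero by (auto simp: cont_chars_def)
  obtain k where k: "(\<lambda>x. \<alpha> x powi k) \<in> char_span I" "(\<lambda>x. \<alpha> x powi k) \<noteq> (\<lambda>_. 1)"
    using maximal_indep_chars_power[OF I max \<alpha> False] by blast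
  have pk: "\<alpha> x powi (int p * v) = 1" for x v
    using p(2)[of x] by (simp add: power_int_mult)
  have "\<not> int p dvd k"
    using k(2) pk by (auto elim!: dvdE)
  then have "coprime (int p) k" using p(1) by (simp add: prime_imp_coprime)
  then obtain u v where uv: "u * int p + v * k = 1"
    using bezout_int[of "int p" k] by auto
  have "(\<alpha> x powi k) powi v = \<alpha> x" for x
  proof -
    have "\<alpha> x = \<alpha> x powi (int p * u + k * v)" using uv by (simp add: mult.commute)
    also have "\<dots> = (\<alpha> x powi k) powi v"
      unfolding power_int_add[OF disjI1[OF nz]] pk by (simp add: power_int_mult)
    finally show ?thesis by simp
  qed
  then show ?thesis using char_group_powi[OF G k(1), of v] by simp
qed

section \<open>Cardinality bounds\<close>

lemma finite_ordLeq_infinite: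
  assumes "finite A" "infinite T"
  shows "|A| \<le>o |T|"
  using assms by (metis card_of_Well_order card_of_ordLeq_finite ordLeq_total)

lemma card_of_Times_ordLeq_infinite:
  assumes "infinite T" "|A| \<le>o |T|" "|B| \<le>o |T|"
  shows "|A \<times> B| \<le>o |T|"
  using card_of_Sigma_ordLeq_infinite[of T A "\<lambda>_. B"] assms by blast

lemma card_of_lists_ordLeq_infinite:
  assumes T: "infinite T" and S: "|S| \<le>o |T|"
  shows "|lists S| \<le>o |T|"
proof -
  define W where "W n = {l \<in> lists S. length l = n}" for n
  have "|W n| \<le>o |T|" for n
  proof (induction n)
    case 0
    have "W 0 = {[]}" by (auto simp: W_def)
    then show ?case using T by (simp add: finite_ordLeq_infinite)
  next
    case (Suc n)
    have "W (Suc n) \<subseteq> (\<lambda>(a, l). a # l) ` (S \<times> W n)"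
      by (force simp: W_def length_Suc_conv)
    then have "|W (Suc n)| \<le>o |S \<times> W n|" by (meson card_of_image card_of_mono1 ordLeq_transitive)
    then show ?case using card_of_Times_ordLeq_infinite[OF T S Suc] ordLeq_transitive by blast
  qed
  then have "|\<Union>n. W n| \<le>o |T|"
    using T infinite_iff_card_of_nat by (intro card_of_UNION_ordLeq_infinite) auto
  moreover have "lists S = (\<Union>n. W n)" by (auto simp: W_def)
  ultimately show ?thesis by simp
qed

lemma card_of_char_span:
  fixes S :: "('a \<Rightarrow> complex) set"
  assumes T: "infinite T" and S: "|S| \<le>o |T|"
  shows "|char_span S| \<le>o |T|"
proof -
  define ev where "ev l = foldr (\<lambda>(b, \<phi>) \<psi>. \<lambda>x. (if b then \<phi> x else cnj (\<phi> x)) * \<psi> x) l (\<lambda>_. 1)"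
    for l :: "(bool \<times> ('a \<Rightarrow> complex)) list"
  have "char_span S \<subseteq> ev ` lists (UNIV \<times> S)"
  proof
    fix \<psi> assume "\<psi> \<in> char_span S"
    then show "\<psi> \<in> ev ` lists (UNIV \<times> S)"
    proof induction
      case one
      show ?case by (rule image_eqI[of _ _ "[]"]) (auto simp: ev_def)
    next
      case (mult \<phi> \<psi>)
      then obtain l where "l \<in> lists (UNIV \<times> S)" "\<psi> = ev l" by blast
      with mult.hyps show ?case by (intro image_eqI[of _ _ "(True, \<phi>) # l"]) (auto simp: ev_def)
    next
      case (inv \<phi> \<psi>)
      then obtain l where "l \<in> lists (UNIV \<times> S)" "\<psi> = ev l" by blast
      with inv.hyps show ?case by (intro image_eqI[of _ _ "(False, \<phi>) # l"]) (auto simp: ev_def)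
    qed
  qed
  then have "|char_span S| \<le>o |lists ((UNIV :: bool set) \<times> S)|"
    by (meson card_of_image card_of_mono1 ordLeq_transitive)
  moreover have "|UNIV :: bool set| \<le>o |T|"
    using T by (intro finite_ordLeq_infinite) auto
  then have "|lists ((UNIV :: bool set) \<times> S)| \<le>o |T|"
    by (intro card_of_lists_ordLeq_infinite T card_of_Times_ordLeq_infinite S)
  ultimately show ?thesis by (rule ordLeq_transitive)
qed

text \<open>
  An essential subgroup \<open>B\<close> is as large as the whole group, up to countable factors. Every
  character has a positive power in \<open>B\<close>, so the sets \<open>R n\<close> of characters whose \<open>n\<close>-th power lies
  in \<open>B\<close> exhaust the group. Taking \<open>p\<close>-th powers maps \<open>R (p * m)\<close> to \<open>R m\<close>, and each fibre lies in
  a coset of the \<open>p\<close>-torsion, which is contained in \<open>B\<close>; so the size of \<open>R n\<close> is bounded by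
  induction over the prime factors of \<open>n\<close>.
\<close>

theorem card_of_cont_chars:
  fixes I :: "('a::topological_ab_group_add \<Rightarrow> complex) set"
  assumes I: "indep_chars I" and max: "\<And>J. indep_chars J \<Longrightarrow> I \<subseteq> J \<Longrightarrow> J = I"
    and T: "infinite T" "|I| \<le>o |T|"
  shows "|cont_chars :: ('a \<Rightarrow> complex) set| \<le>o |T|"
proof -
  define B where "B = char_span I"
  have B: "|B| \<le>o |T|" unfolding B_def by (rule card_of_char_span[OF T])
  have G: "char_group B" unfolding B_def using I by (intro char_group_char_span) (simp add: indep_chars_def)
  have GA: "char_group (cont_chars :: ('a \<Rightarrow> complex) set)" by (rule char_group_cont_chars)
  define R where "R n = {\<alpha> \<in> cont_chars. (\<lambda>x. \<alpha> x ^ n) \<in> B}" for n :: nat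
  have R: "|R n| \<le>o |T|" if "n > 0" for n
    using that
  proof (induction n rule: less_induct)
    case (less n)
    show ?case
    proof (cases "n = 1")
      case True
      then have "R n \<subseteq> B" by (auto simp: R_def)
      then show ?thesis using B by (meson card_of_mono1 ordLeq_transitive)
    next
      case False
      then obtain p where p: "prime p" "p dvd n" using prime_factor_nat by blast
      then obtain m where m: "n = p * m" by blast
      have "p > 1" using p(1) prime_gt_1_nat by blast
      then have m': "0 < m" "m < n" using m \<open>n > 0\<close> by auto
      (* s picks a base point in each fibre, so that a character is determined by its p-th power
         and its quotient by the base point. *)
      define s where "s \<gamma> = (SOME \<alpha>. \<alpha> \<in> R n \<and> (\<lambda>x. \<alpha> x ^ p) = \<gamma>)" for \<gamma>
      have s: "s (\<lambda>x. \<alpha> x ^ p) \<in> R n" "s (\<lambda>x. \<alpha> x ^ p) x ^ p = \<alpha> x ^ p" if "\<alpha> \<in> R n" for \<alpha> x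
      proof -
        have "s (\<lambda>x. \<alpha> x ^ p) \<in> R n \<and> (\<lambda>x. s (\<lambda>x. \<alpha> x ^ p) x ^ p) = (\<lambda>x. \<alpha> x ^ p)"
          unfolding s_def by (rule someI[of _ \<alpha>]) (use that in simp)
        then show "s (\<lambda>x. \<alpha> x ^ p) \<in> R n" "s (\<lambda>x. \<alpha> x ^ p) x ^ p = \<alpha> x ^ p" by (auto dest: fun_cong)
      qed
      define \<theta> where "\<theta> \<alpha> = ((\<lambda>x. \<alpha> x ^ p), (\<lambda>x. cnj (s (\<lambda>x. \<alpha> x ^ p) x) * \<alpha> x))" for \<alpha> :: "'a \<Rightarrow> complex"
      have "inj_on \<theta> (R n)"
      proof (rule inj_onI)
        fix \<alpha> \<beta> assume ab: "\<alpha> \<in> R n" "\<beta> \<in> R n" "\<theta> \<alpha> = \<theta> \<beta>"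
        define \<sigma> where "\<sigma> = s (\<lambda>x. \<alpha> x ^ p)"
        have eq: "(\<lambda>x. \<alpha> x ^ p) = (\<lambda>x. \<beta> x ^ p)" using ab(3) by (simp add: \<theta>_def)
        have "(\<lambda>x. cnj (\<sigma> x) * \<alpha> x) = (\<lambda>x. cnj (\<sigma> x) * \<beta> x)"
          using ab(3) unfolding \<theta>_def \<sigma>_def eq by simp
        then have "cnj (\<sigma> x) * \<alpha> x = cnj (\<sigma> x) * \<beta> x" for x by meson
        moreover have "character \<sigma>" using s(1)[OF ab(1)] by (simp add: \<sigma>_def R_def cont_chars_def)
        ultimately show "\<alpha> = \<beta>" using character_nonzero[of \<sigma>] by auto
      qed
      moreover have "\<theta> ` R n \<subseteq> R m \<times> B"
      proof
        fix w assume "w \<in> \<theta> ` R n"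
        then obtain \<alpha> where \<alpha>: "\<alpha> \<in> R n" "w = \<theta> \<alpha>" by blast
        define \<sigma> where "\<sigma> = s (\<lambda>x. \<alpha> x ^ p)"
        have ac: "\<alpha> \<in> cont_chars" "(\<lambda>x. \<alpha> x ^ n) \<in> B" using \<alpha>(1) by (auto simp: R_def)
        have sc: "\<sigma> \<in> cont_chars" using s(1)[OF \<alpha>(1)] by (simp add: \<sigma>_def R_def)
        have "(\<lambda>x. \<alpha> x ^ p) \<in> R m"
          using ac char_group_power[OF GA ac(1), of p] by (simp add: R_def m power_mult)
        moreover have "(\<lambda>x. cnj (\<sigma> x) * \<alpha> x) \<in> B"
          unfolding B_def
        proof (rule maximal_indep_chars_torsion[OF I max _ p(1)])
          show "(\<lambda>x. cnj (\<sigma> x) * \<alpha> x) \<in> cont_chars"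
            by (intro char_group_mult[OF GA] char_group_cnj[OF GA] sc ac)
          show "(cnj (\<sigma> x) * \<alpha> x) ^ p = 1" for x
          proof -
            have "(cnj (\<sigma> x) * \<alpha> x) ^ p = (cnj (\<sigma> x)) ^ p * \<sigma> x ^ p"
              unfolding power_mult_distrib \<sigma>_def s(2)[OF \<alpha>(1)] ..
            also have "\<dots> = (\<sigma> x * cnj (\<sigma> x)) ^ p" by (simp add: power_mult_distrib)
            also have "\<dots> = 1" using sc by (simp add: character_cnj cont_chars_def)
            finally show ?thesis .
          qed
        qed
        ultimately show "w \<in> R m \<times> B" unfolding \<alpha>(2) \<theta>_def \<sigma>_def by simp
      qed
      ultimately have "|R n| \<le>o |R m \<times> B|" using card_of_ordLeq by blast
      then show ?thesis
        using card_of_Times_ordLeq_infinite[OF T(1) less.IH[OF m'(2,1)] B] ordLeq_transitive by blast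
    qed
  qed
  have "cont_chars \<subseteq> (\<Union>n\<in>{0<..}. R n)"
  proof
    fix \<alpha> :: "'a \<Rightarrow> complex" assume \<alpha>: "\<alpha> \<in> cont_chars"
    show "\<alpha> \<in> (\<Union>n\<in>{0<..}. R n)"
    proof (cases "\<alpha> = (\<lambda>_. 1)")
      case True
      then have "\<alpha> \<in> R 1" using \<alpha> char_group_one[OF G] by (simp add: R_def)
      then show ?thesis by force
    next
      case False
      then obtain k where k: "(\<lambda>x. \<alpha> x powi k) \<in> B" "(\<lambda>x. \<alpha> x powi k) \<noteq> (\<lambda>_. 1)"
        using maximal_indep_chars_power[OF I max \<alpha>] unfolding B_def by blast
      have "k \<noteq> 0" using k(2) by auto
      have "(\<lambda>x. \<alpha> x ^ nat \<bar>k\<bar>) \<in> B"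
      proof (cases "k \<ge> 0")
        case True
        then show ?thesis using k(1) by (simp add: power_int_def)
      next
        case False
        have "cnj (\<alpha> x powi k) = \<alpha> x ^ nat \<bar>k\<bar>" for x
          using False \<alpha> by (simp add: power_int_def inverse_character cont_chars_def)
        then show ?thesis using char_group_cnj[OF G k(1)] by simp
      qed
      then have "\<alpha> \<in> R (nat \<bar>k\<bar>)" using \<alpha> by (simp add: R_def)
      then show ?thesis using \<open>k \<noteq> 0\<close> by force
    qed
  qed
  moreover have "|\<Union>n\<in>{0<..}. R n| \<le>o |T|"
  proof (rule card_of_UNION_ordLeq_infinite[OF T(1)])
    have "|{0<..} :: nat set| \<le>o |UNIV :: nat set|" by (rule card_of_mono1) simp
    then show "|{0<..} :: nat set| \<le>o |T|"
      using T(1) infinite_iff_card_of_nat ordLeq_transitive by blast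
  qed (use R in auto)
  ultimately show ?thesis by (meson card_of_mono1 ordLeq_transitive)
qed

text \<open>
  As the characters separate points of a compact space, the finite intersections of preimages of
  members of a countable base of the complex plane form a base.
\<close>

theorem weight_le_characters:
  fixes T :: "'t set"
  assumes cpt: "compact (UNIV :: 'a::{topological_ab_group_add, t2_space} set)"
    and T: "infinite T" "|cont_chars :: ('a \<Rightarrow> complex) set| \<le>o |T|"
  shows "top_weight (euclidean :: 'a topology) \<le>o |T|"
proof -
  obtain \<O> :: "complex set set" where \<O>: "countable \<O>" "topological_basis \<O>"
    using ex_countable_basis by blast
  define box where "box l = {x. \<forall>(\<xi>, U) \<in> set l. \<xi> x \<in> U}" for l :: "(('a \<Rightarrow> complex) \<times> complex set) list"
  define \<B> where "\<B> = box ` lists (cont_chars \<times> \<O>)"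
  have open_box: "open (box l)" if "l \<in> lists (cont_chars \<times> \<O>)" for l
  proof -
    have "open (\<xi> -` U)" if "(\<xi>, U) \<in> set l" for \<xi> U
    proof (rule open_vimage)
      show "open U" "continuous_on UNIV \<xi>"
        using \<open>l \<in> lists _\<close> that \<O>(2) by (auto simp: cont_chars_def in_lists_conv_set topological_basis_open)
    qed
    then have "open (\<Inter>(\<xi>, U)\<in>set l. \<xi> -` U)" by (intro open_INT) auto
    moreover have "box l = (\<Inter>(\<xi>, U)\<in>set l. \<xi> -` U)" by (auto simp: box_def)
    ultimately show ?thesis by simp
  qed
  have nbhd: "\<exists>l\<in>lists (cont_chars \<times> \<O>). x \<in> box l \<and> box l \<subseteq> U" if U: "open U" "x \<in> U" for U x
  proof -
    have "\<exists>\<xi> O' W. \<xi> \<in> cont_chars \<and> O' \<in> \<O> \<and> \<xi> x \<in> O' \<and> open W \<and> y \<in> W \<and> W \<inter> \<xi> -` O' = {}"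
      if "y \<in> - U" for y
    proof -
      have "y - x \<notin> {0}" using U that by auto
      moreover have "add_subgroup {0 :: 'a}" by (simp add: add_subgroup_def)
      ultimately obtain \<xi> where \<xi>: "\<xi> \<in> cont_chars" "\<xi> (y - x) \<noteq> 1"
        using separating_character[OF cpt _ closed_singleton] by blast
      have char: "character \<xi>" "continuous_on UNIV \<xi>" using \<xi>(1) by (auto simp: cont_chars_def)
      have "\<xi> y \<noteq> \<xi> x"
        using \<xi>(2) character_cnj[OF char(1), of x] by (auto simp: character_diff[OF char(1)])
      then obtain P Q where PQ: "open P" "open Q" "\<xi> y \<in> P" "\<xi> x \<in> Q" "P \<inter> Q = {}"
        using hausdorff by metis
      obtain O' where "O' \<in> \<O>" "\<xi> x \<in> O'" "O' \<subseteq> Q"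
        using topological_basisE[OF \<O>(2) PQ(2,4)] by blast
      moreover have "open (\<xi> -` P)" using PQ char by (intro open_vimage)
      ultimately show ?thesis using \<xi>(1) PQ by (intro exI[of _ \<xi>] exI[of _ O'] exI[of _ "\<xi> -` P"]) auto
    qed
    then obtain f g W where fg: "\<And>y. y \<in> - U \<Longrightarrow> f y \<in> cont_chars \<and> g y \<in> \<O> \<and> f y x \<in> g y \<and>
        open (W y) \<and> y \<in> W y \<and> W y \<inter> f y -` g y = {}"
      by metis
    have "compact (- U)" using compact_Int_closed[OF cpt, of "- U"] U(1) by (simp add: closed_def)
    then obtain C where C: "C \<subseteq> - U" "finite C" "- U \<subseteq> (\<Union>y\<in>C. W y)"
      by (rule compactE_image[of "- U" "- U" W]) (use fg in auto)
    obtain ys where ys: "set ys = C" using finite_list[OF C(2)] by blast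
    define l where "l = map (\<lambda>y. (f y, g y)) ys"
    have "l \<in> lists (cont_chars \<times> \<O>)" "x \<in> box l"
      using fg C(1) ys by (auto simp: l_def box_def in_lists_conv_set)
    moreover have "box l \<subseteq> U"
    proof
      fix z assume z: "z \<in> box l"
      show "z \<in> U"
      proof (rule ccontr)
        assume "z \<notin> U"
        then obtain y where "y \<in> C" "z \<in> W y" using C(3) by blast
        then show False using z fg[of y] C(1) ys by (auto simp: box_def l_def)
      qed
    qed
    ultimately show ?thesis by blast
  qed
  have "base_in euclidean \<B>"
    unfolding base_in_def
  proof (intro conjI ballI allI impI)
    show "openin euclidean B" if "B \<in> \<B>" for B using that open_box by (auto simp: \<B>_def)
    fix U :: "'a set" assume "openin euclidean U"
    then have "\<Union>{B \<in> \<B>. B \<subseteq> U} = U"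
      using nbhd[of U] unfolding \<B>_def by fastforce
    then show "\<exists>\<B>'\<subseteq>\<B>. \<Union>\<B>' = U" by (intro exI[of _ "{B \<in> \<B>. B \<subseteq> U}"]) auto
  qed
  then have "top_weight (euclidean :: 'a topology) \<le>o |\<B>|"
    using top_weight_attained[of "euclidean :: 'a topology"] by auto
  also have "|\<B>| \<le>o |lists ((cont_chars :: ('a \<Rightarrow> complex) set) \<times> \<O>)|"
    unfolding \<B>_def by (rule card_of_image)
  also have "|lists ((cont_chars :: ('a \<Rightarrow> complex) set) \<times> \<O>)| \<le>o |T|"
  proof (intro card_of_lists_ordLeq_infinite card_of_Times_ordLeq_infinite T)
    show "|\<O>| \<le>o |T|"
    proof -
      have "|\<O>| \<le>o |UNIV :: nat set|"
        using \<O>(1) unfolding countable_def card_of_ordLeq[symmetric] by blast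
      then show ?thesis using T(1) infinite_iff_card_of_nat ordLeq_transitive by blast
    qed
  qed
  finally (ordLeq_transitive) show ?thesis .
qed

section \<open>A dense subgroup of maximal density\<close>

text \<open>
  One point of \<open>H\<close> from each member of a base that meets \<open>H\<close>.
\<close>

lemma density_le_weight:
  fixes H :: "'a::topological_space set"
  shows "top_density (subtopology euclidean H) \<le>o top_weight (euclidean :: 'a topology)"
proof -
  obtain \<B> :: "'a set set" where \<B>: "base_in euclidean \<B>" "top_weight (euclidean :: 'a topology) = |\<B>|"
    using top_weight_attained[of "euclidean :: 'a topology"] by (elim exE conjE) (rule that)
  define c where "c B = (SOME x. x \<in> B \<inter> H)" for B
  define E where "E = c ` {B \<in> \<B>. B \<inter> H \<noteq> {}}"
  have c: "c B \<in> B \<inter> H" if "B \<inter> H \<noteq> {}" for B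
    unfolding c_def using that by (rule someI_ex[OF ex_in_conv[THEN iffD2]])
  have "H \<subseteq> closure E"
  proof
    fix x assume "x \<in> H"
    show "x \<in> closure E"
    proof (rule ccontr)
      assume "x \<notin> closure E"
      have "openin euclidean (- closure E)" by (simp add: open_Compl)
      then have "\<exists>\<B>'\<subseteq>\<B>. \<Union>\<B>' = - closure E"
        using \<B>(1) by (simp only: base_in_def)
      then obtain \<B>' where sub: "\<B>' \<subseteq> \<B>" and eq: "\<Union>\<B>' = - closure E"
        by (elim exE conjE) (rule that)
      have "x \<in> \<Union>\<B>'" using \<open>x \<notin> closure E\<close> unfolding eq by simp
      then obtain B where "B \<in> \<B>'" "x \<in> B" by (rule UnionE)
      then have B: "B \<in> \<B>" "x \<in> B" "B \<subseteq> - closure E"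
        using sub eq by auto
      then have "c B \<in> E" "c B \<in> B" using c[of B] \<open>x \<in> H\<close> by (auto simp: E_def)
      then show False using B(3) closure_subset by blast
    qed
  qed
  moreover have "E \<subseteq> H" using c by (auto simp: E_def)
  ultimately have "dense_in (subtopology euclidean H) E"
    by (auto simp: dense_in_def closure_of_subtopology Int_absorb1)
  then have "top_density (subtopology euclidean H) \<le>o |E|"
    using top_density_attained[of "subtopology euclidean H"] by auto
  also have "|E| \<le>o |{B \<in> \<B>. B \<inter> H \<noteq> {}}|" unfolding E_def by (rule card_of_image)
  also have "|{B \<in> \<B>. B \<inter> H \<noteq> {}}| \<le>o |\<B>|" by (rule card_of_mono1) auto
  finally (ordLeq_transitive) show ?thesis using \<B>(2) by simp
qed

lemma density_eq_weightI:
  fixes H :: "'a::topological_space set"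
  assumes dense: "closure H = UNIV"
    and large: "\<And>D. D \<subseteq> H \<Longrightarrow> closure D = UNIV \<Longrightarrow> top_weight (euclidean :: 'a topology) \<le>o |D|"
  shows "top_density (subtopology euclidean H) =o top_weight (euclidean :: 'a topology)"
proof -
  obtain D where D: "dense_in (subtopology euclidean H) D" "top_density (subtopology euclidean H) = |D|"
    using top_density_attained[of "subtopology euclidean H"] by (elim exE conjE) (rule that)
  then have "D \<subseteq> H" "H \<subseteq> closure D"
    by (auto simp: dense_in_def closure_of_subtopology Int_absorb1)
  then have "closure D = UNIV" using dense closure_minimal[of H "closure D"] by auto
  with large[OF \<open>D \<subseteq> H\<close>] D(2) show ?thesis
    using density_le_weight ordIso_iff_ordLeq by metis
qed

lemma dense_eq_UNIV_or_infinite: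
  fixes D :: "'a::t1_space set"
  assumes "closure D = UNIV"
  shows "infinite D \<or> D = UNIV \<and> finite (UNIV :: 'a set)"
  using assms finite_imp_closed[of D] by (metis closure_closed)

lemma finite_weight_le:
  assumes "finite (UNIV :: 'a::t1_space set)"
  shows "top_weight (euclidean :: 'a topology) \<le>o |UNIV :: 'a set|"
proof -
  have "open U" for U :: "'a set"
    using finite_imp_closed[of "- U"] assms by (metis closed_open finite_subset double_complement subset_UNIV)
  then have "base_in euclidean (range (\<lambda>x::'a. {x}))"
    unfolding base_in_def
  proof (intro conjI ballI allI impI)
    fix U :: "'a set"
    show "\<exists>\<B>'\<subseteq>range (\<lambda>x. {x}). \<Union>\<B>' = U"
      by (intro exI[of _ "(\<lambda>x. {x}) ` U"]) auto
  qed simp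
  then have "top_weight (euclidean :: 'a topology) \<le>o |range (\<lambda>x::'a. {x})|"
    using top_weight_attained[of "euclidean :: 'a topology"] by auto
  then show ?thesis using card_of_image ordLeq_transitive by blast
qed

lemma closure_add_subgroup:
  fixes H :: "'a::topological_ab_group_add set"
  assumes "add_subgroup H"
  shows "add_subgroup (closure H)"
  unfolding add_subgroup_def
proof (intro conjI ballI)
  show "0 \<in> closure H" using assms closure_subset by (auto simp: add_subgroup_def)
  show "- x \<in> closure H" if "x \<in> closure H" for x
  proof -
    have "uminus ` closure H \<subseteq> closure H"
      by (rule image_closure_subset)
         (use assms in \<open>auto simp: add_subgroup_def intro!: continuous_intros subsetD[OF closure_subset]\<close>)
    then show ?thesis using that by blast
  qed
  have 1: "h + x \<in> closure H" if "h \<in> H" "x \<in> closure H" for h x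
  proof -
    have "(+) h ` closure H \<subseteq> closure H"
      by (rule image_closure_subset)
         (use assms that in \<open>auto simp: add_subgroup_def intro!: continuous_intros subsetD[OF closure_subset]\<close>)
    then show ?thesis using that by blast
  qed
  show "x + y \<in> closure H" if "x \<in> closure H" "y \<in> closure H" for x y
  proof -
    have "(\<lambda>x. x + y) ` closure H \<subseteq> closure H"
      by (rule image_closure_subset) (use that 1 in \<open>auto intro!: continuous_intros\<close>)
    then show ?thesis using that by blast
  qed
qed

text \<open>
  The analogue of the direct sum inside a direct product, with the characters in \<open>I\<close> as
  coordinates.
\<close>

definition finite_support :: "('a \<Rightarrow> complex) set \<Rightarrow> 'a set" where
  "finite_support I = {x. finite {\<xi> \<in> I. \<xi> x \<noteq> 1}}"

lemma add_subgroup_finite_support: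
  assumes "\<And>\<xi>. \<xi> \<in> I \<Longrightarrow> character \<xi>"
  shows "add_subgroup (finite_support I)"
  unfolding add_subgroup_def
proof (intro conjI ballI)
  show "0 \<in> finite_support I"
  proof -
    have "{\<xi> \<in> I. \<xi> 0 \<noteq> 1} = {}" using assms character_0 by blast
    then show ?thesis unfolding finite_support_def by (simp only: mem_Collect_eq finite.emptyI)
  qed
  show "x + y \<in> finite_support I" if "x \<in> finite_support I" "y \<in> finite_support I" for x y
  proof -
    have "{\<xi> \<in> I. \<xi> (x + y) \<noteq> 1} \<subseteq> {\<xi> \<in> I. \<xi> x \<noteq> 1} \<union> {\<xi> \<in> I. \<xi> y \<noteq> 1}"
      using assms character_add by fastforce
    then show ?thesis using that unfolding finite_support_def by (auto intro: finite_subset)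
  qed
  show "- x \<in> finite_support I" if "x \<in> finite_support I" for x
  proof -
    have "{\<xi> \<in> I. \<xi> (- x) \<noteq> 1} \<subseteq> {\<xi> \<in> I. \<xi> x \<noteq> 1}"
      using assms character_minus by fastforce
    then show ?thesis using that unfolding finite_support_def by (auto intro: finite_subset)
  qed
qed

text \<open>
  A character \<open>\<psi>\<close> that is trivial on this subgroup is trivial on the common kernel of \<open>I - F\<close> for
  every finite \<open>F\<close>, so it lies in the span of \<open>I - F\<close> by duality. By independence \<open>\<psi>\<close> is trivial,
  and \<open>separating_character\<close> leaves no room for a proper closure.
\<close>

lemma finite_support_dense:
  fixes I :: "('a::{topological_ab_group_add, t2_space} \<Rightarrow> complex) set"
  assumes cpt: "compact (UNIV :: 'a set)" and I: "indep_chars I"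
  shows "closure (finite_support I) = UNIV"
proof (rule ccontr)
  assume "closure (finite_support I) \<noteq> UNIV"
  then obtain z where z: "z \<notin> closure (finite_support I)" by blast
  have sub: "I \<subseteq> cont_chars" using I by (simp add: indep_chars_def)
  then have "add_subgroup (closure (finite_support I))"
    by (intro closure_add_subgroup add_subgroup_finite_support) (auto simp: cont_chars_def)
  then obtain \<psi> where \<psi>: "\<psi> \<in> cont_chars" "\<And>x. x \<in> closure (finite_support I) \<Longrightarrow> \<psi> x = 1" "\<psi> z \<noteq> 1"
    using separating_character[OF cpt _ closed_closure z] by blast
  have "\<psi> \<in> char_span (I - F)" if "finite F" "F \<subseteq> I" for F
  proof (rule char_group_annihilator[OF cpt _ \<psi>(1)])
    show "char_group (char_span (I - F))" using sub by (intro char_group_char_span) auto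
    fix x assume trivial: "\<And>\<phi>. \<phi> \<in> char_span (I - F) \<Longrightarrow> \<phi> x = 1"
    have "\<xi> x = 1" if "\<xi> \<in> I - F" for \<xi>
      by (rule trivial[OF char_span_superset[OF that]])
    then have "{\<xi> \<in> I. \<xi> x \<noteq> 1} \<subseteq> F" by blast
    then have "x \<in> finite_support I" using that(1) by (auto simp: finite_support_def intro: finite_subset)
    then show "\<psi> x = 1" by (intro \<psi>(2) subsetD[OF closure_subset])
  qed
  then have "\<psi> = (\<lambda>_. 1)" by (rule indep_chars_cofinite[OF I])
  with \<psi>(3) show False by simp
qed

text \<open>
  Fewer than \<open>|I|\<close> points involve, together, fewer than \<open>|I|\<close> characters. A character of \<open>I\<close> that
  none of them involves has a proper closed kernel that contains all of them.
\<close>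

lemma finite_support_dense_subset:
  fixes I :: "('a::{topological_ab_group_add, t2_space} \<Rightarrow> complex) set"
  assumes I: "indep_chars I" "infinite I" and D: "D \<subseteq> finite_support I" "closure D = UNIV"
  shows "|I| \<le>o |D|"
proof (rule ccontr)
  assume "\<not> |I| \<le>o |D|"
  then have less: "|D| <o |I|" by (simp add: not_ordLeq_iff_ordLess card_of_Well_order)
  define S where "S = (\<Union>x\<in>D. {\<xi> \<in> I. \<xi> x \<noteq> 1})"
  have fin: "finite {\<xi> \<in> I. \<xi> x \<noteq> 1}" if "x \<in> D" for x
    using D(1) that by (auto simp: finite_support_def)
  have "S \<noteq> I"
  proof (cases "finite D")
    case True
    then have "finite S" using fin by (auto simp: S_def)
    then show ?thesis using I(2) by blast
  next
    case False
    have "|S| \<le>o |D|"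
      unfolding S_def
    proof (rule card_of_UNION_ordLeq_infinite[OF False])
      show "\<forall>x\<in>D. |{\<xi> \<in> I. \<xi> x \<noteq> 1}| \<le>o |D|"
        using fin False by (auto intro!: finite_ordLeq_infinite)
    qed (rule card_of_mono1[OF order_refl])
    then show ?thesis using less not_ordLess_ordLeq by blast
  qed
  then obtain \<xi> where \<xi>: "\<xi> \<in> I" "\<xi> \<notin> S" by (auto simp: S_def)
  have "continuous_on UNIV \<xi>" using \<xi>(1) I(1) by (auto simp: indep_chars_def cont_chars_def)
  then have "closed {x. \<xi> x = 1}" by (intro closed_Collect_eq continuous_intros)
  moreover have "D \<subseteq> {x. \<xi> x = 1}" using \<xi> by (auto simp: S_def)
  ultimately have "closure D \<subseteq> {x. \<xi> x = 1}" by (rule closure_minimal[rotated])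
  then have "\<xi> = (\<lambda>_. 1)" using D(2) by auto
  then show False using \<xi>(1) I(1) by (simp add: indep_chars_def)
qed

theorem theoremA:
  assumes "compact (UNIV :: 'a::{topological_ab_group_add, t2_space} set)"
  shows "\<exists>H :: 'a::{topological_ab_group_add, t2_space} set. add_subgroup H \<and> dense_in euclidean H \<and>
           top_density (subtopology euclidean H) =o
           top_weight (euclidean :: 'a::{topological_ab_group_add, t2_space} topology)"
proof -
  note cpt = assms
  obtain I :: "('a \<Rightarrow> complex) set"
    where I: "indep_chars I" and max: "\<And>J. indep_chars J \<Longrightarrow> I \<subseteq> J \<Longrightarrow> J = I"
    using exists_maximal_indep_chars by metis
  have "\<exists>H :: 'a set. add_subgroup H \<and> closure H = UNIV \<and>
      (\<forall>D\<subseteq>H. closure D = UNIV \<longrightarrow> top_weight (euclidean :: 'a topology) \<le>o |D| )"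
  proof (cases "finite I")
    case False
    have weight: "top_weight (euclidean :: 'a topology) \<le>o |I|"
      by (intro weight_le_characters[OF cpt False] card_of_cont_chars[OF I max False] card_of_mono1[OF order_refl])
    have "add_subgroup (finite_support I)"
      using I by (intro add_subgroup_finite_support) (auto simp: indep_chars_def cont_chars_def)
    moreover have "top_weight (euclidean :: 'a topology) \<le>o |D|"
      if "D \<subseteq> finite_support I" "closure D = UNIV" for D
      using weight finite_support_dense_subset[OF I False that] ordLeq_transitive by blast
    ultimately show ?thesis using finite_support_dense[OF cpt I] by blast
  next
    case True
    (* The group is second countable here, and the whole group serves as H: its dense subsets are
       infinite, unless the group is finite and discrete. *)
    have nat: "infinite (UNIV :: nat set)" by simp
    have "|I| \<le>o |UNIV :: nat set|"
      using True by (intro finite_ordLeq_infinite) auto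
    then have weight: "top_weight (euclidean :: 'a topology) \<le>o |UNIV :: nat set|"
      by (intro weight_le_characters[OF cpt nat] card_of_cont_chars[OF I max nat])
    have "top_weight (euclidean :: 'a topology) \<le>o |D|" if "closure D = UNIV" for D :: "'a set"
      using dense_eq_UNIV_or_infinite[OF that]
    proof
      assume "infinite D"
      then show ?thesis using weight infinite_iff_card_of_nat ordLeq_transitive by blast
    next
      assume "D = UNIV \<and> finite (UNIV :: 'a set)"
      then show ?thesis using finite_weight_le by auto
    qed
    then show ?thesis by (intro exI[of _ UNIV]) (auto simp: add_subgroup_def)
  qed
  then obtain H :: "'a set" where H: "add_subgroup H" "closure H = UNIV"
    "\<And>D. D \<subseteq> H \<Longrightarrow> closure D = UNIV \<Longrightarrow> top_weight (euclidean :: 'a topology) \<le>o |D|"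
    by blast
  then show ?thesis
    using density_eq_weightI[OF H(2,3)] by (auto simp: dense_in_def)
qed

end
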